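(* The geodesics of the Finsler-Poincaré upper half plane $(\mathbb{U},F_U)$ are the vertical rays in $\mathbb{U}$ and the semicircles in $\mathbb{U}$ centred on the $x_1$-axis. More precisely, under the isometry $g:(\mathbb{D},F_F)\to(\mathbb{U},F_U)$: (i) the line segments in the Funk disc passing through $(-1,0)$ correspond to the vertical rays in the upper half plane; (ii) the vertical line segments in the Funk disc correspond to the concentric semicircles centred at the origin; (iii) the other line segments in the Funk disc correspond to the semicircles centred on the $x_1$-axis.
   Context: Coordinates are written with subscripts; $|\cdot|$ and $\langle\cdot,\cdot\rangle$ are the Euclidean norm and inner product. Geodesics are regarded as point sets (trajectories of complete-as-possible geodesics). $\mathbb{D}=\{x\in\mathbb{R}^2:|x|<1\}$ with the Funk metric $F_F(x,v)=\dfrac{\sqrt{(1-|x|^2)|v|^2+\langle x,v\rangle^2}}{1-|x|^2}+\dfrac{\langle x,v\rangle}{1-|x|^2}$, whose geodesics, as point sets, are the straight line segments in $\mathbb{D}$; "line segments in the Funk disc" means maximal ones, i.e. open chords $\ell\cap\mathbb{D}$ with $\ell$ a line meeting $\mathbb{D}$. A segment passes through $(-1,0)$ if the line $\ell$ contains this boundary point. $\mathbb{U}=\{(x_1,x_2)\in\mathbb{R}^2:x_2>0\}$ with $F_U(x,v)=\dfrac{|v|}{x_2}+\dfrac{\langle w(x),v\rangle}{x_2(4+|x|^2)}$, where $w(x)=(2x_1x_2,\;x_2^2-x_1^2-4)$. The map $g:\mathbb{D}\to\mathbb{U}$, $g(x)=\left(\dfrac{2x_2}{1+x_1},\dfrac{2\sqrt{1-|x|^2}}{1+x_1}\right)$,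 is a (known) isometry from $(\mathbb{D},F_F)$ to $(\mathbb{U},F_U)$, i.e. a diffeomorphism with $F_U(g(x),Dg_x(v))=F_F(x,v)$. "Correspond" means: are mapped by $g$ to. *)

theory Defs
  imports "HOL-Analysis.Analysis"
begin

primrec times_differentiable_on ::
    "nat \<Rightarrow> 'a::real_normed_vector set \<Rightarrow> ('a \<Rightarrow> 'b::real_normed_vector) \<Rightarrow> bool" where
  "times_differentiable_on 0 S f \<longleftrightarrow> continuous_on S f"
| "times_differentiable_on (Suc n) S f \<longleftrightarrow>
     (\<forall>x\<in>S. f differentiable (at x)) \<and>
     (\<forall>v. times_differentiable_on n S (\<lambda>x. frechet_derivative f (at x) v))"

text \<open>For an open subset of a finite-dimensional space this is the usual notion of a
  \<open>C\<^sup>\<infinity>\<close> map: all iterated directional derivatives exist and are continuous.\<close>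

definition smooth_on :: "'a::real_normed_vector set \<Rightarrow> ('a \<Rightarrow> 'b::real_normed_vector) \<Rightarrow> bool" where
  "smooth_on S f \<longleftrightarrow> (\<forall>n. times_differentiable_on n S f)"

text \<open>A Finsler metric, not necessarily reversible, on the open set \<open>M\<close> is a function \<open>F x v\<close> of the base point \<open>x \<in> M\<close> and the
  tangent vector \<open>v\<close>.\<close>

definition finsler_length ::
    "('a::real_normed_vector \<Rightarrow> 'a \<Rightarrow> real) \<Rightarrow> (real \<Rightarrow> 'a) \<Rightarrow> real \<Rightarrow> real \<Rightarrow> real" where
  "finsler_length F c a b = integral {a..b} (\<lambda>t. F (c t) (vector_derivative c (at t)))"

text \<open>Competitors are the piecewise \<open>C\<^sup>1\<close> curves in \<open>M\<close> with the same initial and the same final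
  point; the order matters, since \<open>F\<close> need not be reversible. The library predicate
  \<^const>\<open>piecewise_C1_differentiable_on\<close> puts no bound on the derivative near the exceptional
  points, so it also admits curves of infinite length, for which \<^const>\<open>integral\<close> returns the
  junk value 0. The integrability condition removes exactly these.\<close>

definition length_minimizing_on ::
    "('a::real_normed_vector \<Rightarrow> 'a \<Rightarrow> real) \<Rightarrow> 'a set \<Rightarrow> (real \<Rightarrow> 'a) \<Rightarrow> real \<Rightarrow> real \<Rightarrow> bool" where
  "length_minimizing_on F M c a b \<longleftrightarrow>
     (\<forall>\<sigma>. \<sigma> piecewise_C1_differentiable_on {0..1} \<and> \<sigma> ` {0..1} \<subseteq> M \<and>
          \<sigma> 0 = c a \<and> \<sigma> 1 = c b \<and>
          (\<lambda>t. F (\<sigma> t) (vector_derivative \<sigma> (at t))) integrable_on {0..1}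
       \<longrightarrow> finsler_length F c a b \<le> finsler_length F \<sigma> 0 1)"

text \<open>A geodesic is a smooth curve of constant (nonzero) speed on an open interval that is locally
  length minimizing. The values of \<open>c\<close> outside \<open>I\<close> are irrelevant.\<close>

definition finsler_geodesic ::
    "('a::real_normed_vector \<Rightarrow> 'a \<Rightarrow> real) \<Rightarrow> 'a set \<Rightarrow> real set \<Rightarrow> (real \<Rightarrow> 'a) \<Rightarrow> bool" where
  "finsler_geodesic F M I c \<longleftrightarrow>
     open I \<and> is_interval I \<and> I \<noteq> {} \<and>
     smooth_on I c \<and> c ` I \<subseteq> M \<and>
     (\<exists>k>0. \<forall>t\<in>I. F (c t) (vector_derivative c (at t)) = k) \<and>
     (\<forall>t\<in>I. \<exists>\<epsilon>>0. {t - \<epsilon>..t + \<epsilon>} \<subseteq> I \<and> length_minimizing_on F M c (t - \<epsilon>) (t + \<epsilon>))"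

definition maximal_geodesic ::
    "('a::real_normed_vector \<Rightarrow> 'a \<Rightarrow> real) \<Rightarrow> 'a set \<Rightarrow> real set \<Rightarrow> (real \<Rightarrow> 'a) \<Rightarrow> bool" where
  "maximal_geodesic F M I c \<longleftrightarrow>
     finsler_geodesic F M I c \<and>
     (\<forall>J d. finsler_geodesic F M J d \<and> I \<subseteq> J \<and> (\<forall>t\<in>I. d t = c t) \<longrightarrow> J = I)"

definition geodesic_trajectories ::
    "('a::real_normed_vector \<Rightarrow> 'a \<Rightarrow> real) \<Rightarrow> 'a set \<Rightarrow> 'a set set" where
  "geodesic_trajectories F M = {c ` I | I c. maximal_geodesic F M I c}"

definition finsler_isometry ::
    "('a::real_normed_vector \<Rightarrow> 'a \<Rightarrow> real) \<Rightarrow> 'a set \<Rightarrow>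
     ('b::real_normed_vector \<Rightarrow> 'b \<Rightarrow> real) \<Rightarrow> 'b set \<Rightarrow> ('a \<Rightarrow> 'b) \<Rightarrow> bool" where
  "finsler_isometry F M G N f \<longleftrightarrow>
     bij_betw f M N \<and> smooth_on M f \<and> smooth_on N (inv_into M f) \<and>
     (\<forall>x\<in>M. \<forall>v. G (f x) (frechet_derivative f (at x) v) = F x v)"

definition disc :: "(real^2) set" where
  "disc = {x. norm x < 1}"

definition funk_metric :: "real^2 \<Rightarrow> real^2 \<Rightarrow> real" where
  "funk_metric x v =
     sqrt ((1 - (norm x)\<^sup>2) * (norm v)\<^sup>2 + (x \<bullet> v)\<^sup>2) / (1 - (norm x)\<^sup>2)
     + (x \<bullet> v) / (1 - (norm x)\<^sup>2)"

definition upper_half_plane :: "(real^2) set" where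
  "upper_half_plane = {x. x$2 > 0}"

definition fp_form :: "real^2 \<Rightarrow> real^2" where
  "fp_form x = vector [2 * x$1 * x$2, (x$2)\<^sup>2 - (x$1)\<^sup>2 - 4]"

definition fp_metric :: "real^2 \<Rightarrow> real^2 \<Rightarrow> real" where
  "fp_metric x v = norm v / x$2 + (fp_form x \<bullet> v) / (x$2 * (4 + (norm x)\<^sup>2))"

definition funk_to_fp :: "real^2 \<Rightarrow> real^2" where
  "funk_to_fp x = vector [2 * x$2 / (1 + x$1), 2 * sqrt (1 - (norm x)\<^sup>2) / (1 + x$1)]"

text \<open>The line segments in the Funk disc are the chords \<open>l \<inter> disc\<close> with \<open>l\<close> in the following
  set. They are indexed by their lines because a boundary point such as \<open>(-1, 0)\<close> lies on the
  line, but not on the open chord.\<close>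

definition chord_lines :: "(real^2) set set" where
  "chord_lines = {l. affine l \<and> aff_dim l = 1 \<and> l \<inter> disc \<noteq> {}}"

definition vertical_line :: "(real^2) set \<Rightarrow> bool" where
  "vertical_line l \<longleftrightarrow> (\<exists>a. l = {x. x$1 = a})"

definition vertical_ray :: "real \<Rightarrow> (real^2) set" where
  "vertical_ray a = {x \<in> upper_half_plane. x$1 = a}"

definition semicircle :: "real \<Rightarrow> real \<Rightarrow> (real^2) set" where
  "semicircle a r = {x \<in> upper_half_plane. dist x (vector [a, 0]) = r}"

end

theory Submission
  imports Defs
begin

text \<open>The isometry carries geodesics to geodesics, so everything is decided in the Funk disc. There
  \<open>|F x + v| = F\<close> for \<open>F = F(x, v)\<close>, so for every boundary point \<open>B\<close> the Cauchy-Schwarz inequality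
  gives \<open>\<langle>v, B\<rangle> / (1 - \<langle>x, B\<rangle>) \<le> F(x, v)\<close>, with equality only for \<open>v = F (B - x)\<close>. The left-hand side is
  the differential of \<open>- ln (1 - \<langle>x, B\<rangle>)\<close>, so this function calibrates the segments heading for \<open>B\<close>: a
  minimizer of constant speed \<open>k\<close> satisfies \<open>c' = k (B - c)\<close>, with \<open>B\<close> locally and hence globally
  constant. Thus \<open>c t = B + exp (- k t) C\<close>, and the maximal ones are exactly the chords. On the chord
  \<open>a\<^sub>1 x\<^sub>1 + a\<^sub>2 x\<^sub>2 = b\<close> the inverse of the isometry,
  \<open>x\<^sub>1 = (4 - |y|\<^sup>2) / (4 + |y|\<^sup>2)\<close> and \<open>x\<^sub>2 = 4 y\<^sub>1 / (4 + |y|\<^sup>2)\<close>, yields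
  \<open>(a\<^sub>1 + b) |y|\<^sup>2 - 4 a\<^sub>2 y\<^sub>1 + 4 (b - a\<^sub>1) = 0\<close>, a vertical line iff \<open>a\<^sub>1 + b = 0\<close> and a
  circle around the origin iff \<open>a\<^sub>2 = 0\<close>.\<close>

section \<open>Smooth maps\<close>

lemma times_differentiable_on_Suc_imp:
  assumes "times_differentiable_on (Suc n) S f"
  shows "times_differentiable_on n S f"
  using assms
proof (induction n arbitrary: f)
  case 0
  then show ?case
    by (auto intro!: differentiable_imp_continuous_on
        simp: differentiable_on_def differentiable_at_withinI)
next
  case (Suc n)
  then show ?case
    by (metis times_differentiable_on.simps(2))
qed

text \<open>For open \<open>S\<close>, agreement on \<open>S\<close> is agreement near each of its
  points, so the derivatives agree there too and the induction can pass to them.\<close>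

lemma times_differentiable_on_cong:
  assumes "open S" "\<And>x. x \<in> S \<Longrightarrow> f x = g x" "times_differentiable_on n S f"
  shows "times_differentiable_on n S g"
  using assms(2,3)
proof (induction n arbitrary: f g)
  case 0
  then show ?case
    using continuous_on_cong by (metis times_differentiable_on.simps(1))
next
  case (Suc n)
  have D: "(g has_derivative frechet_derivative f (at x)) (at x)" if "x \<in> S" for x
  proof (rule has_derivative_transform_within_open[OF _ \<open>open S\<close> that])
    show "(f has_derivative frechet_derivative f (at x)) (at x)"
      using Suc.prems(2) that by (auto simp: frechet_derivative_works[THEN iffD1])
  qed (use Suc.prems(1) in auto)
  have eq: "frechet_derivative f (at x) = frechet_derivative g (at x)" if "x \<in> S" for x
    using D[OF that] frechet_derivative_at by blast
  show ?case
    unfolding times_differentiable_on.simps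
  proof (intro conjI ballI allI)
    show "g differentiable at x" if "x \<in> S" for x
      using D[OF that] by (rule differentiableI)
    show "times_differentiable_on n S (\<lambda>x. frechet_derivative g (at x) v)" for v
      by (rule Suc.IH[of "\<lambda>x. frechet_derivative f (at x) v"]) (use Suc.prems(2) eq in auto)
  qed
qed

text \<open>Lets the inductions below work with an explicit derivative \<open>f'\<close>, which by
  uniqueness coincides with \<open>frechet_derivative\<close> on \<open>S\<close>.\<close>

lemma times_differentiable_on_SucI:
  assumes "open S"
    and "\<And>x. x \<in> S \<Longrightarrow> (f has_derivative f' x) (at x)"
    and "\<And>v. times_differentiable_on n S (\<lambda>x. f' x v)"
  shows "times_differentiable_on (Suc n) S f"
  unfolding times_differentiable_on.simps
proof (intro conjI ballI allI)
  show "f differentiable at x" if "x \<in> S" for x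
    using assms(2)[OF that] by (rule differentiableI)
  show "times_differentiable_on n S (\<lambda>x. frechet_derivative f (at x) v)" for v
    by (rule times_differentiable_on_cong[OF assms(1) _ assms(3)[of v]])
      (use assms(2) frechet_derivative_at in metis)
qed

lemma times_differentiable_on_SucD:
  assumes "times_differentiable_on (Suc n) S f"
  shows "x \<in> S \<Longrightarrow> (f has_derivative frechet_derivative f (at x)) (at x)"
    and "times_differentiable_on n S (\<lambda>x. frechet_derivative f (at x) v)"
  using assms by (auto simp: frechet_derivative_works[THEN iffD1])

lemma times_differentiable_on_const:
  assumes "open S" shows "times_differentiable_on n S (\<lambda>x. c)"
proof (induction n arbitrary: c)
  case (Suc n)
  show ?case
    by (rule times_differentiable_on_SucI[OF assms has_derivative_const Suc])
qed simp

lemma times_differentiable_on_bounded_linear: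
  assumes "open S" "bounded_linear f" shows "times_differentiable_on n S f"
proof (cases n)
  case 0
  then show ?thesis by (simp add: assms(2) linear_continuous_on)
next
  case (Suc m)
  show ?thesis unfolding Suc
    by (rule times_differentiable_on_SucI[OF assms(1) bounded_linear_imp_has_derivative[OF assms(2)]])
      (rule times_differentiable_on_const[OF assms(1)])
qed

lemma times_differentiable_on_add:
  assumes "open S" "times_differentiable_on n S f" "times_differentiable_on n S g"
  shows "times_differentiable_on n S (\<lambda>x. f x + g x)"
  using assms(2,3)
proof (induction n arbitrary: f g)
  case 0
  then show ?case by (simp add: continuous_on_add)
next
  case (Suc n)
  show ?case
  proof (rule times_differentiable_on_SucI[OF assms(1)])
    show "((\<lambda>x. f x + g x) has_derivative
        (\<lambda>v. frechet_derivative f (at x) v + frechet_derivative g (at x) v)) (at x)" if "x \<in> S" for x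
      by (intro has_derivative_add times_differentiable_on_SucD(1)[OF Suc.prems(1) that]
          times_differentiable_on_SucD(1)[OF Suc.prems(2) that])
    show "times_differentiable_on n S
        (\<lambda>x. frechet_derivative f (at x) v + frechet_derivative g (at x) v)" for v
      by (rule Suc.IH[OF times_differentiable_on_SucD(2)[OF Suc.prems(1)]
            times_differentiable_on_SucD(2)[OF Suc.prems(2)]])
  qed
qed

lemma times_differentiable_on_sum:
  assumes "open S" "\<And>i. i \<in> A \<Longrightarrow> times_differentiable_on n S (f i)"
  shows "times_differentiable_on n S (\<lambda>x. \<Sum>i\<in>A. f i x)"
  using assms(2)
  by (induction A rule: infinite_finite_induct)
    (auto intro!: times_differentiable_on_add times_differentiable_on_const assms(1))

text \<open>Each Leibniz term pairs an undifferentiated factor with a derivative, both of order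
  \<open>n\<close>, so the induction closes. One proof covers scaling, multiplication and the inner
  product.\<close>

lemma times_differentiable_on_bilinear:
  assumes "bounded_bilinear pr" "open S"
    "times_differentiable_on n S f" "times_differentiable_on n S g"
  shows "times_differentiable_on n S (\<lambda>x. pr (f x) (g x))"
  using assms(3,4)
proof (induction n arbitrary: f g)
  case 0
  then show ?case by (simp add: bounded_bilinear.continuous_on[OF assms(1)])
next
  case (Suc n)
  show ?case
  proof (rule times_differentiable_on_SucI[OF assms(2)])
    show "((\<lambda>x. pr (f x) (g x)) has_derivative
        (\<lambda>v. pr (f x) (frechet_derivative g (at x) v) + pr (frechet_derivative f (at x) v) (g x)))
        (at x)" if "x \<in> S" for x
      by (intro bounded_bilinear.FDERIV[OF assms(1)] times_differentiable_on_SucD(1)[OF Suc.prems(1) that]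
          times_differentiable_on_SucD(1)[OF Suc.prems(2) that])
    show "times_differentiable_on n S
        (\<lambda>x. pr (f x) (frechet_derivative g (at x) v) + pr (frechet_derivative f (at x) v) (g x))" for v
      by (intro times_differentiable_on_add assms(2) Suc.IH
          times_differentiable_on_SucD(2)[OF Suc.prems(1)] times_differentiable_on_SucD(2)[OF Suc.prems(2)]
          times_differentiable_on_Suc_imp[OF Suc.prems(1)] times_differentiable_on_Suc_imp[OF Suc.prems(2)])
  qed
qed

text \<open>The chain rule gives \<open>?Df (g x) (?Dg x v)\<close>, whose direction moves with
  \<open>x\<close>, whereas the induction hypothesis speaks of derivatives in a fixed direction.
  Expanding in \<open>Basis\<close> reduces to fixed directions.\<close>

lemma times_differentiable_on_compose:
  fixes f :: "'b::euclidean_space \<Rightarrow> 'c::real_normed_vector"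
  assumes "open S" "open T" "g ` S \<subseteq> T"
    "times_differentiable_on n T f" "times_differentiable_on n S g"
  shows "times_differentiable_on n S (\<lambda>x. f (g x))"
  using assms(3,4,5)
proof (induction n arbitrary: f)
  case 0
  then show ?case by (auto intro: continuous_on_compose2)
next
  case (Suc n)
  let ?Df = "\<lambda>y. frechet_derivative f (at y)" and ?Dg = "\<lambda>x. frechet_derivative g (at x)"
  show ?case
  proof (rule times_differentiable_on_SucI[OF assms(1)])
    fix x assume x: "x \<in> S"
    have gx: "g x \<in> T" using x Suc.prems(1) by auto
    have f: "(f has_derivative ?Df (g x)) (at (g x))"
      by (rule times_differentiable_on_SucD(1)[OF Suc.prems(2) gx])
    have lin: "linear (?Df (g x))" using f by (rule has_derivative_linear)
    have "(\<Sum>b\<in>Basis. (?Dg x v \<bullet> b) *\<^sub>R ?Df (g x) b) = ?Df (g x) (?Dg x v)" for v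
      using linear_sum[OF lin, of "\<lambda>b. (?Dg x v \<bullet> b) *\<^sub>R b" Basis]
      by (simp add: linear_scale[OF lin] euclidean_representation)
    moreover have "((\<lambda>x. f (g x)) has_derivative (\<lambda>v. ?Df (g x) (?Dg x v))) (at x)"
      by (rule has_derivative_compose[OF times_differentiable_on_SucD(1)[OF Suc.prems(3) x] f])
    ultimately show "((\<lambda>x. f (g x)) has_derivative
        (\<lambda>v. \<Sum>b\<in>Basis. (?Dg x v \<bullet> b) *\<^sub>R ?Df (g x) b)) (at x)"
      by simp
  next
    fix v
    have "times_differentiable_on n S (\<lambda>x. ?Df (g x) b)" for b
      by (rule Suc.IH[OF Suc.prems(1) times_differentiable_on_SucD(2)[OF Suc.prems(2)]
            times_differentiable_on_Suc_imp[OF Suc.prems(3)]])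
    then show "times_differentiable_on n S (\<lambda>x. \<Sum>b\<in>Basis. (?Dg x v \<bullet> b) *\<^sub>R ?Df (g x) b)"
      by (intro times_differentiable_on_sum times_differentiable_on_bilinear[OF bounded_bilinear_scaleR]
          times_differentiable_on_bilinear[OF bounded_bilinear_inner] assms(1)
          times_differentiable_on_const times_differentiable_on_SucD(2)[OF Suc.prems(3)])
  qed
qed

section \<open>Smoothness of sums, products, compositions, powers and exponentials\<close>

lemma smooth_on_cong:
  "open S \<Longrightarrow> (\<And>x. x \<in> S \<Longrightarrow> f x = g x) \<Longrightarrow> smooth_on S f \<Longrightarrow> smooth_on S g"
  unfolding smooth_on_def using times_differentiable_on_cong by metis

lemma smooth_on_const: "open S \<Longrightarrow> smooth_on S (\<lambda>x. c)"
  by (simp add: smooth_on_def times_differentiable_on_const)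

lemma smooth_on_bounded_linear: "open S \<Longrightarrow> bounded_linear f \<Longrightarrow> smooth_on S f"
  by (simp add: smooth_on_def times_differentiable_on_bounded_linear)

lemma smooth_on_add:
  "open S \<Longrightarrow> smooth_on S f \<Longrightarrow> smooth_on S g \<Longrightarrow> smooth_on S (\<lambda>x. f x + g x)"
  by (simp add: smooth_on_def times_differentiable_on_add)

lemma smooth_on_bilinear:
  "bounded_bilinear pr \<Longrightarrow> open S \<Longrightarrow> smooth_on S f \<Longrightarrow> smooth_on S g
    \<Longrightarrow> smooth_on S (\<lambda>x. pr (f x) (g x))"
  by (simp add: smooth_on_def times_differentiable_on_bilinear)

lemmas smooth_on_scaleR = smooth_on_bilinear[OF bounded_bilinear_scaleR]
lemmas smooth_on_mult = smooth_on_bilinear[OF bounded_bilinear_mult]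
lemmas smooth_on_inner = smooth_on_bilinear[OF bounded_bilinear_inner]

lemma smooth_on_compose:
  fixes f :: "'b::euclidean_space \<Rightarrow> 'c::real_normed_vector"
  shows "open S \<Longrightarrow> open T \<Longrightarrow> g ` S \<subseteq> T \<Longrightarrow> smooth_on T f \<Longrightarrow> smooth_on S g
    \<Longrightarrow> smooth_on S (\<lambda>x. f (g x))"
  unfolding smooth_on_def using times_differentiable_on_compose by metis

lemma smooth_on_imp_has_derivative:
  assumes "smooth_on S f" "x \<in> S"
  shows "(f has_derivative frechet_derivative f (at x)) (at x)"
  using assms times_differentiable_on_SucD(1) unfolding smooth_on_def by blast

lemma smooth_on_imp_continuous_on_frechet:
  assumes "smooth_on S f"
  shows "continuous_on S (\<lambda>x. frechet_derivative f (at x) v)"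
  using times_differentiable_on_SucD(2)[of 0 S f v] assms unfolding smooth_on_def
  by (simp del: times_differentiable_on.simps(2))

text \<open>The exponent varies in the induction, since each derivative lowers it by one. The
  exponents -1 and 1/2 yield reciprocals and square roots.\<close>

lemma smooth_on_powr: "smooth_on {0<..} (\<lambda>x::real. x powr a)"
proof -
  have "times_differentiable_on n {0<..} (\<lambda>x::real. x powr a)" for n
  proof (induction n arbitrary: a)
    case 0
    then show ?case by (auto intro!: continuous_intros)
  next
    case (Suc n)
    show ?case
    proof (rule times_differentiable_on_SucI)
      show "((\<lambda>x. x powr a) has_derivative (\<lambda>v. v * (a * x powr (a - 1)))) (at x)"
        if "x \<in> {0<..}" for x :: real
        using has_real_derivative_powr[of x a] that
        by (simp add: has_field_derivative_def mult.commute[of _ "a * x powr (a - 1)"])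
      show "times_differentiable_on n {0<..} (\<lambda>x::real. v * (a * x powr (a - 1)))" for v
        by (intro times_differentiable_on_bilinear[OF bounded_bilinear_mult]
            times_differentiable_on_const Suc.IH open_greaterThan)
    qed simp
  qed
  then show ?thesis by (simp add: smooth_on_def)
qed

lemma smooth_on_inverse:
  assumes "open S" "smooth_on S f" "\<And>x. x \<in> S \<Longrightarrow> (f x :: real) > 0"
  shows "smooth_on S (\<lambda>x. inverse (f x))"
proof (rule smooth_on_cong[OF assms(1)])
  show "smooth_on S (\<lambda>x. f x powr (-1))"
    by (rule smooth_on_compose[OF assms(1) _ _ smooth_on_powr assms(2)]) (use assms(3) in auto)
qed (use assms(3) in \<open>simp add: powr_minus less_imp_le\<close>)

lemma smooth_on_divide:
  assumes "open S" "smooth_on S g" "smooth_on S f" "\<And>x. x \<in> S \<Longrightarrow> (f x :: real) > 0"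
  shows "smooth_on S (\<lambda>x. g x / f x)"
  unfolding divide_inverse using assms by (intro smooth_on_mult smooth_on_inverse)

lemma smooth_on_sqrt:
  assumes "open S" "smooth_on S f" "\<And>x. x \<in> S \<Longrightarrow> (f x :: real) > 0"
  shows "smooth_on S (\<lambda>x. sqrt (f x))"
proof (rule smooth_on_cong[OF assms(1)])
  show "smooth_on S (\<lambda>x. f x powr (1/2))"
    by (rule smooth_on_compose[OF assms(1) _ _ smooth_on_powr assms(2)]) (use assms(3) in auto)
qed (use assms(3) in \<open>simp add: powr_half_sqrt less_imp_le\<close>)

text \<open>The derivative in a fixed direction is a constant multiple of the function
  itself.\<close>

lemma smooth_on_exp_scaled:
  assumes "open S" shows "smooth_on S (\<lambda>t::real. exp (k * t))"
proof -
  have "times_differentiable_on n S (\<lambda>t. exp (k * t))" for n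
  proof (induction n)
    case 0
    then show ?case by (auto intro!: continuous_intros)
  next
    case (Suc n)
    show ?case
    proof (rule times_differentiable_on_SucI[OF assms])
      show "((\<lambda>t. exp (k * t)) has_derivative (\<lambda>v. (k * v) * exp (k * t))) (at t)" for t
        by (auto intro!: derivative_eq_intros)
      show "times_differentiable_on n S (\<lambda>t. (k * v) * exp (k * t))" for v
        by (intro times_differentiable_on_bilinear[OF bounded_bilinear_mult]
            times_differentiable_on_const Suc assms)
    qed
  qed
  then show ?thesis by (simp add: smooth_on_def)
qed

section \<open>Isometries preserve geodesics\<close>

lemma finsler_isometry_in:
  "finsler_isometry F M G N f \<Longrightarrow> x \<in> M \<Longrightarrow> f x \<in> N"
  unfolding finsler_isometry_def by (meson bij_betwE)

lemma finsler_isometry_inv_into: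
  "finsler_isometry F M G N f \<Longrightarrow> x \<in> M \<Longrightarrow> inv_into M f (f x) = x"
  unfolding finsler_isometry_def by (meson bij_betw_inv_into_left)

lemma finsler_isometry_f_inv_into:
  "finsler_isometry F M G N f \<Longrightarrow> y \<in> N \<Longrightarrow> f (inv_into M f y) = y"
  unfolding finsler_isometry_def by (meson bij_betw_inv_into_right)

text \<open>Differentiating \<open>f (?h y) = y\<close> shows that the derivative of
  \<open>f\<close> undoes that of \<open>?h\<close>; the metric identity of \<open>f\<close> in the
  direction \<open>frechet_derivative ?h (at y) w\<close> is then the one for
  \<open>?h\<close>.\<close>

lemma finsler_isometry_inverse:
  assumes iso: "finsler_isometry F M G N f" and "open M" "open N"
  shows "finsler_isometry G N F M (inv_into M f)"
proof -
  let ?h = "inv_into M f"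
  have bij: "bij_betw f M N" and sm: "smooth_on M f" and smh: "smooth_on N ?h"
    and metric: "\<And>x v. x \<in> M \<Longrightarrow> G (f x) (frechet_derivative f (at x) v) = F x v"
    using iso by (auto simp: finsler_isometry_def)
  have bijh: "bij_betw ?h N M" using bij by (rule bij_betw_inv_into)
  \<comment> \<open>\<open>inv_into N ?h\<close> is known to agree with \<open>f\<close> on
    \<open>M\<close> only, which suffices because \<open>M\<close> is open.\<close>
  have "smooth_on M (inv_into N ?h)"
    by (rule smooth_on_cong[OF \<open>open M\<close> _ sm]) (use bij in \<open>simp add: inv_into_inv_into_eq\<close>)
  moreover have "F (?h y) (frechet_derivative ?h (at y) w) = G y w" if y: "y \<in> N" for y w
  proof -
    let ?x = "?h y"
    have x: "?x \<in> M" using bijh y by (meson bij_betwE)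
    have fx: "f ?x = y" using finsler_isometry_f_inv_into[OF iso y] .
    have h': "(?h has_derivative frechet_derivative ?h (at y)) (at y)"
      by (rule smooth_on_imp_has_derivative[OF smh y])
    have f': "(f has_derivative frechet_derivative f (at ?x)) (at ?x)"
      by (rule smooth_on_imp_has_derivative[OF sm x])
    have "((\<lambda>y. f (?h y)) has_derivative (\<lambda>w. frechet_derivative f (at ?x) (frechet_derivative ?h (at y) w))) (at y)"
      by (rule has_derivative_compose[OF h' f'])
    then have "((\<lambda>y. y) has_derivative (\<lambda>w. frechet_derivative f (at ?x) (frechet_derivative ?h (at y) w))) (at y)"
      by (rule has_derivative_transform_within_open[OF _ \<open>open N\<close> y])
        (use finsler_isometry_f_inv_into[OF iso] in auto)
    then have "(\<lambda>w. frechet_derivative f (at ?x) (frechet_derivative ?h (at y) w)) = (\<lambda>w. w)"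
      using has_derivative_ident has_derivative_unique by blast
    then have "frechet_derivative f (at ?x) (frechet_derivative ?h (at y) w) = w" by meson
    then show ?thesis using metric[OF x, of "frechet_derivative ?h (at y) w"] fx by simp
  qed
  ultimately show ?thesis
    unfolding finsler_isometry_def using bijh smh by blast
qed

lemma isometry_has_vector_derivative:
  assumes iso: "finsler_isometry F M G N f"
    and c: "(c has_vector_derivative c') (at t)" "c t \<in> M"
  shows "((\<lambda>t. f (c t)) has_vector_derivative frechet_derivative f (at (c t)) c') (at t)"
proof -
  have f': "(f has_derivative frechet_derivative f (at (c t))) (at (c t))"
    using iso c(2) smooth_on_imp_has_derivative unfolding finsler_isometry_def by blast
  have "((\<lambda>t. f (c t)) has_derivative (\<lambda>s. frechet_derivative f (at (c t)) (s *\<^sub>R c'))) (at t)"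
    by (rule has_derivative_compose[OF c(1)[unfolded has_vector_derivative_def] f'])
  then show ?thesis
    by (simp add: has_vector_derivative_def linear_scale[OF has_derivative_linear[OF f']])
qed

lemma isometry_speed:
  assumes iso: "finsler_isometry F M G N f"
    and c: "c differentiable at t" "c t \<in> M"
  shows "G (f (c t)) (vector_derivative (\<lambda>t. f (c t)) (at t)) = F (c t) (vector_derivative c (at t))"
proof -
  have "vector_derivative (\<lambda>t. f (c t)) (at t) = frechet_derivative f (at (c t)) (vector_derivative c (at t))"
    by (rule vector_derivative_at[OF isometry_has_vector_derivative[OF iso
            vector_derivative_works[THEN iffD1, OF c(1)] c(2)]])
  then show ?thesis
    using iso c(2) by (simp add: finsler_isometry_def)
qed

lemma isometry_finsler_length:
  assumes "finsler_isometry F M G N f"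
    and "\<And>t. t \<in> {a..b} \<Longrightarrow> c differentiable at t \<and> c t \<in> M"
  shows "finsler_length G (\<lambda>t. f (c t)) a b = finsler_length F c a b"
  unfolding finsler_length_def by (rule integral_cong) (use isometry_speed assms in blast)

lemma isometry_piecewise_C1:
  fixes f :: "'a::euclidean_space \<Rightarrow> 'b::real_normed_vector"
  assumes iso: "finsler_isometry F M G N f"
    and \<sigma>: "\<sigma> piecewise_C1_differentiable_on {0..1}" "\<sigma> ` {0..1} \<subseteq> M"
  shows "(\<lambda>t. f (\<sigma> t)) piecewise_C1_differentiable_on {0..1}"
proof -
  have sm: "smooth_on M f" using iso by (simp add: finsler_isometry_def)
  then have cf: "continuous_on M f"
    unfolding smooth_on_def using times_differentiable_on.simps(1) by blast
  obtain X D where c\<sigma>: "continuous_on {0..1} \<sigma>" and X: "finite X"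
    and D: "\<And>t. t \<in> {0..1} - X \<Longrightarrow> (\<sigma> has_vector_derivative D t) (at t)" "continuous_on ({0..1} - X) D"
    using \<sigma>(1) unfolding piecewise_C1_differentiable_on_def C1_differentiable_on_def by blast
  let ?D = "\<lambda>t. frechet_derivative f (at (\<sigma> t)) (D t)"
  \<comment> \<open>Continuity of the derivative of \<open>f\<close> is available for fixed
    directions, hence the expansion of \<open>D t\<close> in the basis.\<close>
  have "continuous_on ({0..1} - X) (\<lambda>t. \<Sum>b\<in>Basis. (D t \<bullet> b) *\<^sub>R frechet_derivative f (at (\<sigma> t)) b)"
  proof (intro continuous_on_sum continuous_on_scaleR continuous_on_inner D(2) continuous_on_const)
    show "continuous_on ({0..1} - X) (\<lambda>t. frechet_derivative f (at (\<sigma> t)) b)" for b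
      by (rule continuous_on_compose2[OF smooth_on_imp_continuous_on_frechet[OF sm] continuous_on_subset[OF c\<sigma>]])
        (use \<sigma>(2) in auto)
  qed
  moreover have "(\<Sum>b\<in>Basis. (D t \<bullet> b) *\<^sub>R frechet_derivative f (at (\<sigma> t)) b) = ?D t"
    if "t \<in> {0..1} - X" for t
  proof -
    have "linear (frechet_derivative f (at (\<sigma> t)))"
      using smooth_on_imp_has_derivative[OF sm] \<sigma>(2) that has_derivative_linear by blast
    from linear_sum[OF this, of "\<lambda>b. (D t \<bullet> b) *\<^sub>R b" Basis] linear_scale[OF this]
    show ?thesis by (simp add: euclidean_representation)
  qed
  ultimately have "continuous_on ({0..1} - X) ?D"
    using continuous_on_cong by (metis (no_types, lifting))
  moreover have "((\<lambda>t. f (\<sigma> t)) has_vector_derivative ?D t) (at t)" if "t \<in> {0..1} - X" for t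
    by (rule isometry_has_vector_derivative[OF iso D(1)[OF that]]) (use \<sigma>(2) that in auto)
  ultimately have "(\<lambda>t. f (\<sigma> t)) C1_differentiable_on ({0..1} - X)"
    unfolding C1_differentiable_on_def by (intro exI[of _ ?D]) simp
  moreover have "continuous_on {0..1} (\<lambda>t. f (\<sigma> t))"
    by (rule continuous_on_compose2[OF cf c\<sigma> \<sigma>(2)])
  ultimately show ?thesis
    unfolding piecewise_C1_differentiable_on_def using X by metis
qed

lemma piecewise_C1_imp_differentiable_except:
  assumes "\<sigma> piecewise_C1_differentiable_on S"
  obtains X where "finite X" "\<And>t. t \<in> S - X \<Longrightarrow> \<sigma> differentiable at t"
  using assms unfolding piecewise_C1_differentiable_on_def C1_differentiable_on_def
  by (metis differentiableI_vector)

text \<open>The inverse isometry pulls a competitor in \<open>N\<close> back to a competitor in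
  \<open>M\<close> of the same length.\<close>

lemma isometry_length_minimizing:
  fixes f :: "'a::euclidean_space \<Rightarrow> 'b::euclidean_space"
  assumes iso: "finsler_isometry F M G N f" and "open M" "open N"
    and c: "\<And>t. t \<in> {a..b} \<Longrightarrow> c differentiable at t \<and> c t \<in> M" "a \<le> b"
    and min: "length_minimizing_on F M c a b"
  shows "length_minimizing_on G N (\<lambda>t. f (c t)) a b"
  unfolding length_minimizing_on_def
proof (intro allI impI, elim conjE)
  fix \<sigma>
  assume \<sigma>: "\<sigma> piecewise_C1_differentiable_on {0..1}" "\<sigma> ` {0..1} \<subseteq> N"
    "\<sigma> 0 = f (c a)" "\<sigma> 1 = f (c b)"
    and int: "(\<lambda>t. G (\<sigma> t) (vector_derivative \<sigma> (at t))) integrable_on {0..1}"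
  let ?h = "inv_into M f"
  let ?\<tau> = "\<lambda>t. ?h (\<sigma> t)"
  have isoh: "finsler_isometry G N F M ?h"
    by (rule finsler_isometry_inverse) (use assms in auto)
  obtain X where X: "finite X" "\<And>t. t \<in> {0..1} - X \<Longrightarrow> \<sigma> differentiable at t"
    using \<sigma>(1) piecewise_C1_imp_differentiable_except by blast
  \<comment> \<open>The speeds are compared off the finite set \<open>X\<close> only; neither
    integrability nor the integral is affected by it.\<close>
  have speed: "F (?\<tau> t) (vector_derivative ?\<tau> (at t)) = G (\<sigma> t) (vector_derivative \<sigma> (at t))"
    if "t \<in> {0..1} - X" for t
    by (rule isometry_speed[OF isoh X(2)[OF that]]) (use \<sigma>(2) that in auto)
  have "finsler_length F c a b \<le> finsler_length F ?\<tau> 0 1"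
  proof (rule min[unfolded length_minimizing_on_def, rule_format], intro conjI)
    show "?\<tau> piecewise_C1_differentiable_on {0..1}"
      by (rule isometry_piecewise_C1[OF isoh \<sigma>(1,2)])
    show "?\<tau> ` {0..1} \<subseteq> M"
      using finsler_isometry_in[OF isoh] \<sigma>(2) by auto
    show "?\<tau> 0 = c a" "?\<tau> 1 = c b"
      using finsler_isometry_inv_into[OF iso] \<sigma>(3,4) c by auto
    show "(\<lambda>t. F (?\<tau> t) (vector_derivative ?\<tau> (at t))) integrable_on {0..1}"
      by (rule integrable_spike_finite[OF X(1) speed int])
  qed
  also have "finsler_length F ?\<tau> 0 1 = finsler_length G \<sigma> 0 1"
    unfolding finsler_length_def
    by (rule integral_spike[OF negligible_finite[OF X(1)]]) (use speed in simp)
  finally show "finsler_length G (\<lambda>t. f (c t)) a b \<le> finsler_length G \<sigma> 0 1"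
    by (subst isometry_finsler_length[OF iso c(1)])
qed

section \<open>Transport of geodesics and of their trajectories\<close>

lemma smooth_on_imp_differentiable: "smooth_on S f \<Longrightarrow> x \<in> S \<Longrightarrow> f differentiable at x"
  using smooth_on_imp_has_derivative differentiableI by blast

lemma isometry_geodesic:
  fixes f :: "'a::euclidean_space \<Rightarrow> 'b::euclidean_space"
  assumes iso: "finsler_isometry F M G N f" and op: "open M" "open N"
    and geo: "finsler_geodesic F M I c"
  shows "finsler_geodesic G N I (\<lambda>t. f (c t))"
proof -
  have I: "open I" "is_interval I" "I \<noteq> {}" and sm: "smooth_on I c" and cM: "c ` I \<subseteq> M"
    and sp: "\<exists>k>0. \<forall>t\<in>I. F (c t) (vector_derivative c (at t)) = k"
    and min: "\<forall>t\<in>I. \<exists>\<epsilon>>0. {t - \<epsilon>..t + \<epsilon>} \<subseteq> I \<and> length_minimizing_on F M c (t - \<epsilon>) (t + \<epsilon>)"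
    using geo unfolding finsler_geodesic_def by blast+
  have diff: "c differentiable at t \<and> c t \<in> M" if "t \<in> I" for t
    using smooth_on_imp_differentiable[OF sm that] cM that by auto
  have "smooth_on I (\<lambda>t. f (c t))"
    by (rule smooth_on_compose[OF I(1) op(1) cM _ sm]) (use iso in \<open>simp add: finsler_isometry_def\<close>)
  moreover have "(\<lambda>t. f (c t)) ` I \<subseteq> N"
    using finsler_isometry_in[OF iso] cM by auto
  moreover have "\<exists>k>0. \<forall>t\<in>I. G (f (c t)) (vector_derivative (\<lambda>t. f (c t)) (at t)) = k"
    using sp isometry_speed[OF iso] diff by metis
  moreover have "\<exists>\<epsilon>>0. {t - \<epsilon>..t + \<epsilon>} \<subseteq> I \<and> length_minimizing_on G N (\<lambda>t. f (c t)) (t - \<epsilon>) (t + \<epsilon>)"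
    if t: "t \<in> I" for t
  proof -
    obtain \<epsilon> where e: "\<epsilon> > 0" "{t - \<epsilon>..t + \<epsilon>} \<subseteq> I" "length_minimizing_on F M c (t - \<epsilon>) (t + \<epsilon>)"
      using min t by blast
    then have "length_minimizing_on G N (\<lambda>t. f (c t)) (t - \<epsilon>) (t + \<epsilon>)"
      by (intro isometry_length_minimizing[OF iso op]) (use diff in auto)
    with e show ?thesis by blast
  qed
  ultimately show ?thesis
    unfolding finsler_geodesic_def using I by blast
qed

text \<open>\<open>I\<close> is open, so derivatives at its points, and with them speeds and lengths
  over subintervals, depend only on the values on \<open>I\<close>.\<close>

lemma finsler_geodesic_cong:
  assumes "finsler_geodesic F M I c" "\<And>t. t \<in> I \<Longrightarrow> d t = c t"
  shows "finsler_geodesic F M I d"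
proof -
  have I: "open I" "is_interval I" "I \<noteq> {}" and sm: "smooth_on I c" and cM: "c ` I \<subseteq> M"
    using assms(1) unfolding finsler_geodesic_def by blast+
  have "smooth_on I d" by (rule smooth_on_cong[OF I(1) _ sm]) (use assms(2) in simp)
  moreover have vd: "vector_derivative d (at t) = vector_derivative c (at t)" if "t \<in> I" for t
    using vector_derivative_works[THEN iffD1, OF smooth_on_imp_differentiable[OF sm that]] assms(2)
    by (intro vector_derivative_at) (metis has_vector_derivative_transform_within_open I(1) that)
  moreover have "finsler_length F d a b = finsler_length F c a b" if "{a..b} \<subseteq> I" for a b
    unfolding finsler_length_def by (rule integral_cong) (use vd that assms(2) in auto)
  then have "length_minimizing_on F M d (t - \<epsilon>) (t + \<epsilon>)"
    if "{t - \<epsilon>..t + \<epsilon>} \<subseteq> I" "\<epsilon> > 0" "length_minimizing_on F M c (t - \<epsilon>) (t + \<epsilon>)" for t \<epsilon>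
    using that assms(2) unfolding length_minimizing_on_def
    by (smt (verit, best) atLeastAtMost_iff subset_iff)
  ultimately show ?thesis
    using assms unfolding finsler_geodesic_def
    by (smt (verit, best) image_cong)
qed

text \<open>An extension of the image curve is pulled back by the inverse isometry to an extension
  of \<open>c\<close>, which cannot be proper.\<close>

lemma isometry_maximal_geodesic:
  fixes f :: "'a::euclidean_space \<Rightarrow> 'b::euclidean_space"
  assumes iso: "finsler_isometry F M G N f" and op: "open M" "open N"
    and max: "maximal_geodesic F M I c"
  shows "maximal_geodesic G N I (\<lambda>t. f (c t))"
  unfolding maximal_geodesic_def
proof (intro conjI allI impI, goal_cases)
  case 1
  then show ?case
    using isometry_geodesic[OF iso op] max unfolding maximal_geodesic_def by blast
next
  case (2 J d)
  have "finsler_geodesic F M J (\<lambda>t. inv_into M f (d t))"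
    using isometry_geodesic[OF finsler_isometry_inverse[OF iso op] op(2,1)] 2 by blast
  moreover have "inv_into M f (d t) = c t" if "t \<in> I" for t
    using 2 that max finsler_isometry_inv_into[OF iso]
    unfolding maximal_geodesic_def finsler_geodesic_def by auto
  ultimately show ?case
    using max 2 unfolding maximal_geodesic_def by blast
qed

text \<open>One inclusion is \<open>isometry_maximal_geodesic\<close> for \<open>f\<close>, the
  other the same lemma for the inverse.\<close>

lemma isometry_geodesic_trajectories:
  fixes f :: "'a::euclidean_space \<Rightarrow> 'b::euclidean_space"
  assumes iso: "finsler_isometry F M G N f" and op: "open M" "open N"
  shows "geodesic_trajectories G N = (\<lambda>A. f ` A) ` geodesic_trajectories F M"
proof (intro equalityI subsetI)
  fix A assume "A \<in> geodesic_trajectories G N"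
  then obtain I c where c: "maximal_geodesic G N I c" "A = c ` I"
    unfolding geodesic_trajectories_def by blast
  let ?d = "\<lambda>t. inv_into M f (c t)"
  have "maximal_geodesic F M I ?d"
    by (rule isometry_maximal_geodesic[OF finsler_isometry_inverse[OF iso op] op(2,1) c(1)])
  moreover have "f ` ?d ` I = A"
    using c finsler_isometry_f_inv_into[OF iso]
    unfolding maximal_geodesic_def finsler_geodesic_def image_image
    by (auto simp: image_subset_iff intro!: image_cong)
  ultimately show "A \<in> (\<lambda>A. f ` A) ` geodesic_trajectories F M"
    unfolding geodesic_trajectories_def by blast
next
  fix A assume "A \<in> (\<lambda>A. f ` A) ` geodesic_trajectories F M"
  then obtain I c where "maximal_geodesic F M I c" "A = f ` c ` I"
    unfolding geodesic_trajectories_def by blast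
  then show "A \<in> geodesic_trajectories G N"
    using isometry_maximal_geodesic[OF iso op]
    unfolding geodesic_trajectories_def image_image by blast
qed

section \<open>The Funk disc\<close>

lemma open_disc: "open disc"
proof -
  have "disc = ball 0 1" by (auto simp: disc_def)
  then show ?thesis by (metis open_ball)
qed

lemma disc_norm_sq: "x \<in> disc \<Longrightarrow> (norm x)\<^sup>2 < 1"
  by (simp add: disc_def power_less_one_iff)

lemma disc_inner_less:
  assumes "x \<in> disc" "norm B = 1" shows "x \<bullet> B < 1"
  using norm_cauchy_schwarz[of x B] assms by (simp add: disc_def)

text \<open>For \<open>v \<noteq> 0\<close> this says that \<open>x + v / F(x, v)\<close> lies on the unit circle.\<close>

lemma funk_metric_norm:
  assumes "x \<in> disc"
  shows "norm (funk_metric x v *\<^sub>R x + v) = funk_metric x v"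
proof -
  define d where "d = 1 - (norm x)\<^sup>2"
  define s where "s = x \<bullet> v"
  define R where "R = sqrt (d * (norm v)\<^sup>2 + s\<^sup>2)"
  have d: "d > 0" using disc_norm_sq[OF assms] by (simp add: d_def)
  have F: "d * funk_metric x v = R + s"
    using d by (simp add: funk_metric_def d_def R_def s_def divide_simps)
  have R2: "R\<^sup>2 = d * (norm v)\<^sup>2 + s\<^sup>2" using d by (simp add: R_def)
  have sR: "\<bar>s\<bar> \<le> R" unfolding R_def using d by (intro real_le_rsqrt) simp
  have F0: "funk_metric x v \<ge> 0"
  proof -
    have "0 \<le> d * funk_metric x v" unfolding F using sR by linarith
    then show ?thesis using d by (simp add: zero_le_mult_iff)
  qed
  let ?F = "funk_metric x v"
  \<comment> \<open>Squaring the claim gives the quadratic equation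
    \<open>d F^2 - 2 s F - |v|^2 = 0\<close>, whose larger root is the Funk metric. It is multiplied
    by \<open>d\<close> so that the fact \<open>F\<close> can be inserted without division.\<close>
  have "d * (d * ?F\<^sup>2 - 2 * s * ?F - (norm v)\<^sup>2) = (d * ?F)\<^sup>2 - 2 * s * (d * ?F) - d * (norm v)\<^sup>2"
    by (simp add: power2_eq_square algebra_simps)
  also have "\<dots> = 0" unfolding F by (simp add: R2 power2_sum algebra_simps power2_eq_square[of s])
  finally have "d * ?F\<^sup>2 - 2 * s * ?F - (norm v)\<^sup>2 = 0" using d by simp
  moreover have "(norm (?F *\<^sub>R x + v))\<^sup>2 = ?F\<^sup>2 * (norm x)\<^sup>2 + 2 * s * ?F + (norm v)\<^sup>2"
    unfolding power2_norm_eq_inner s_def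
    by (simp add: inner_add_left inner_add_right inner_commute power2_eq_square algebra_simps)
  ultimately have "(norm (?F *\<^sub>R x + v))\<^sup>2 = ?F\<^sup>2"
    by (simp add: d_def algebra_simps)
  then show ?thesis using F0 by (simp add: power2_eq_iff_nonneg)
qed

lemma funk_metric_nonneg: "x \<in> disc \<Longrightarrow> funk_metric x v \<ge> 0"
  using funk_metric_norm norm_ge_zero by metis

lemma funk_metric_pos:
  assumes "x \<in> disc" "v \<noteq> 0" shows "funk_metric x v > 0"
  using funk_metric_norm[OF assms(1), of v] funk_metric_nonneg[OF assms(1), of v] assms(2)
  by (cases "funk_metric x v = 0") auto

text \<open>For this vector the expression under the root is the square of
  \<open>k * (1 - s)\<close>, whose sign is fixed by \<open>k \<ge> 0\<close> and
  \<open>s < 1\<close>. The speed can thus be read off from a velocity pointing at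
  \<open>B\<close>.\<close>

lemma funk_metric_towards:
  assumes "x \<in> disc" "norm B = 1" "k \<ge> 0"
  shows "funk_metric x (k *\<^sub>R (B - x)) = k"
proof -
  define s n where "s = x \<bullet> B" and "n = (norm x)\<^sup>2"
  have n: "n < 1" and s: "s < 1"
    using disc_norm_sq disc_inner_less assms by (auto simp: s_def n_def)
  have BB: "B \<bullet> B = 1" using assms(2) by (simp add: dot_square_norm)
  have v: "(norm (k *\<^sub>R (B - x)))\<^sup>2 = k\<^sup>2 * (1 - 2 * s + n)"
    unfolding power2_norm_eq_inner s_def n_def
    by (simp add: inner_diff_left inner_diff_right BB inner_commute power2_eq_square algebra_simps)
  have xv: "x \<bullet> (k *\<^sub>R (B - x)) = k * (s - n)"
    by (simp add: s_def n_def inner_diff_right power2_norm_eq_inner)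
  have "(1 - n) * (k\<^sup>2 * (1 - 2 * s + n)) + (k * (s - n))\<^sup>2 = (k * (1 - s))\<^sup>2"
    by (simp add: power2_eq_square algebra_simps)
  then have "sqrt ((1 - n) * (k\<^sup>2 * (1 - 2 * s + n)) + (k * (s - n))\<^sup>2) = k * (1 - s)"
    using assms(3) s by simp
  then have "funk_metric x (k *\<^sub>R (B - x)) = k * (1 - s) / (1 - n) + k * (s - n) / (1 - n)"
    unfolding funk_metric_def v xv n_def[symmetric] by simp
  also have "\<dots> = (k * (1 - n)) / (1 - n)"
    unfolding add_divide_distrib[symmetric] by (simp add: algebra_simps)
  also have "\<dots> = k" using n by simp
  finally show ?thesis .
qed

section \<open>Calibration by boundary points\<close>

lemma funk_metric_ge:
  assumes "x \<in> disc" "norm B = 1"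
  shows "(v \<bullet> B) / (1 - x \<bullet> B) \<le> funk_metric x v"
proof -
  have "(funk_metric x v *\<^sub>R x + v) \<bullet> B \<le> funk_metric x v"
    using norm_cauchy_schwarz[of "funk_metric x v *\<^sub>R x + v" B] funk_metric_norm[OF assms(1), of v]
      assms(2) by simp
  then show ?thesis
    using disc_inner_less[OF assms] by (simp add: inner_add_left pos_divide_le_eq algebra_simps)
qed

text \<open>Equality in Cauchy-Schwarz makes \<open>?u\<close> a nonnegative multiple of
  \<open>B\<close>; as its norm is \<open>?F\<close>, it is \<open>?F *\<^sub>R B\<close>.\<close>

lemma funk_metric_ge_eqD:
  assumes "x \<in> disc" "norm B = 1" "(v \<bullet> B) / (1 - x \<bullet> B) = funk_metric x v"
  shows "v = funk_metric x v *\<^sub>R (B - x)"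
proof -
  let ?F = "funk_metric x v" and ?u = "funk_metric x v *\<^sub>R x + v"
  have "?u \<bullet> B = ?F"
    using assms(3) disc_inner_less[OF assms(1,2)]
    by (simp add: inner_add_left divide_simps) (simp add: algebra_simps)
  then have "?u \<bullet> B = norm ?u * norm B"
    using funk_metric_norm[OF assms(1), of v] assms(2) by simp
  then have "norm ?u *\<^sub>R B = norm B *\<^sub>R ?u" by (simp only: norm_cauchy_schwarz_eq)
  then have "?F *\<^sub>R B = ?F *\<^sub>R x + v"
    using funk_metric_norm[OF assms(1), of v] assms(2) by simp
  then show ?thesis by (simp add: algebra_simps)
qed

text \<open>For a unit vector \<open>B\<close>, \<open>1 - x \<bullet> B\<close> is the Euclidean
  distance from \<open>x\<close> to the tangent of the unit circle at \<open>B\<close>. Along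
  segments heading for \<open>B\<close> the gain of this function is the Funk length.\<close>

definition busemann :: "real^2 \<Rightarrow> real^2 \<Rightarrow> real" where
  "busemann B x = - ln (1 - x \<bullet> B)"

lemma busemann_has_derivative:
  assumes "(c has_vector_derivative c') (at t)" "c t \<in> disc" "norm B = 1"
  shows "((\<lambda>t. busemann B (c t)) has_vector_derivative (c' \<bullet> B) / (1 - c t \<bullet> B)) (at t)"
proof -
  have "((\<lambda>t. c t \<bullet> B) has_vector_derivative c' \<bullet> B) (at t)"
    by (rule bounded_linear.has_vector_derivative[OF bounded_linear_inner_left assms(1)])
  then have "((\<lambda>t. c t \<bullet> B) has_real_derivative c' \<bullet> B) (at t)"
    by (simp add: has_real_derivative_iff_has_vector_derivative)
  then have "((\<lambda>t. busemann B (c t)) has_real_derivative (c' \<bullet> B) / (1 - c t \<bullet> B)) (at t)"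
    unfolding busemann_def using disc_inner_less[OF assms(2,3)]
    by (auto intro!: derivative_eq_intros simp: divide_simps)
  then show ?thesis by (simp add: has_real_derivative_iff_has_vector_derivative)
qed

lemma funk_length_ge_busemann:
  assumes \<sigma>: "\<sigma> piecewise_C1_differentiable_on {0..1}" "\<sigma> ` {0..1} \<subseteq> disc"
    and int: "(\<lambda>t. funk_metric (\<sigma> t) (vector_derivative \<sigma> (at t))) integrable_on {0..1}"
    and B: "norm B = 1"
  shows "busemann B (\<sigma> 1) - busemann B (\<sigma> 0) \<le> finsler_length funk_metric \<sigma> 0 1"
proof -
  obtain X where X: "finite X" "\<And>t. t \<in> {0..1} - X \<Longrightarrow> \<sigma> differentiable at t"
    using \<sigma>(1) piecewise_C1_imp_differentiable_except by blast
  have c\<sigma>: "continuous_on {0..1} \<sigma>"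
    using \<sigma>(1) unfolding piecewise_C1_differentiable_on_def by blast
  have in_disc: "\<sigma> t \<in> disc" if "t \<in> {0..1}" for t using \<sigma>(2) that by auto
  let ?\<phi> = "\<lambda>t. (vector_derivative \<sigma> (at t) \<bullet> B) / (1 - \<sigma> t \<bullet> B)"
  have "(?\<phi> has_integral (busemann B (\<sigma> 1) - busemann B (\<sigma> 0))) {0..1}"
  \<comment> \<open>The curve is differentiable only off the finite set \<open>X\<close>; there, and
    at the endpoints, this form of the fundamental theorem asks for continuity alone.\<close>
  proof (rule fundamental_theorem_of_calculus_interior_strong[OF X(1)])
    show "((\<lambda>t. busemann B (\<sigma> t)) has_vector_derivative ?\<phi> t) (at t)"
      if "t \<in> {0<..<1} - X" for t
      by (rule busemann_has_derivative[OF vector_derivative_works[THEN iffD1, OF X(2)] in_disc B])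
        (use that in auto)
    show "continuous_on {0..1} (\<lambda>t. busemann B (\<sigma> t))"
      unfolding busemann_def using disc_inner_less[OF in_disc B]
      by (intro continuous_intros c\<sigma>) fastforce
  qed simp
  moreover have "((\<lambda>t. funk_metric (\<sigma> t) (vector_derivative \<sigma> (at t))) has_integral
      finsler_length funk_metric \<sigma> 0 1) {0..1}"
    unfolding finsler_length_def using int by (rule integrable_integral)
  ultimately show ?thesis
    \<comment> \<open>\<open>funk_metric_ge\<close> holds for every vector, so it also covers the
      exceptional points, whatever value \<open>vector_derivative\<close> takes there.\<close>
    by (rule has_integral_le) (use funk_metric_ge in_disc B in blast)
qed

lemma finsler_length_constant_speed:
  assumes "\<And>t. t \<in> {a..b} \<Longrightarrow> F (c t) (vector_derivative c (at t)) = k" "a \<le> b"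
  shows "finsler_length F c a b = k * (b - a)"
proof -
  have "finsler_length F c a b = integral {a..b} (\<lambda>t. k)"
    unfolding finsler_length_def by (rule integral_cong) (use assms in auto)
  then show ?thesis using assms(2) by simp
qed

text \<open>The ray from \<open>p\<close> through \<open>q\<close> meets the unit circle at \<open>B = p + (q - p) / F(p, q - p)\<close>.\<close>

lemma funk_segment:
  assumes p: "p \<in> disc" and q: "q \<in> disc" and "p \<noteq> q"
  obtains B \<sigma> where "norm B = 1"
    "\<sigma> piecewise_C1_differentiable_on {0..1}" "\<sigma> ` {0..1} \<subseteq> disc" "\<sigma> 0 = p" "\<sigma> 1 = q"
    "(\<lambda>t. funk_metric (\<sigma> t) (vector_derivative \<sigma> (at t))) integrable_on {0..1}"
    "finsler_length funk_metric \<sigma> 0 1 = busemann B q - busemann B p"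
proof -
  define F where "F = funk_metric p (q - p)"
  define B where "B = p + (1 / F) *\<^sub>R (q - p)"
  define \<sigma> where "\<sigma> t = p + t *\<^sub>R (q - p)" for t :: real
  have F: "F > 0" unfolding F_def using funk_metric_pos[OF p] \<open>p \<noteq> q\<close> by simp
  have FB: "q - p = F *\<^sub>R (B - p)" using F by (simp add: B_def)
  have "norm (F *\<^sub>R B) = F"
    using funk_metric_norm[OF p, of "q - p"] F by (simp add: B_def F_def[symmetric] scaleR_add_right)
  then have B: "norm B = 1" using F by simp
  have in_disc: "\<sigma> t \<in> disc" if "t \<in> {0..1}" for t
  proof -
    have "convex disc" by (metis convex_ball disc_def mem_ball_0 Collect_mem_eq Collect_cong)
    moreover have "\<sigma> t = (1 - t) *\<^sub>R p + t *\<^sub>R q" by (simp add: \<sigma>_def algebra_simps)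
    ultimately show ?thesis using p q that by (simp add: convexD)
  qed
  have vd: "(\<sigma> has_vector_derivative (q - p)) (at t)" for t
    unfolding \<sigma>_def by (auto intro!: derivative_eq_intros)
  then have vd': "vector_derivative \<sigma> (at t) = q - p" for t by (rule vector_derivative_at)
  \<comment> \<open>As a function of \<open>t\<close> the left-hand side is affine, and it vanishes
    at \<open>t = 1 / F\<close>, where the line reaches \<open>B\<close>.\<close>
  have gap: "1 - \<sigma> t \<bullet> B = (1 - t * F) * (1 - p \<bullet> B)" for t
  proof -
    have "(q - p) \<bullet> B = F * (1 - p \<bullet> B)"
      using B unfolding FB by (simp add: inner_diff_left dot_square_norm)
    moreover have "1 - \<sigma> t \<bullet> B = 1 - p \<bullet> B - t * ((q - p) \<bullet> B)"
      by (simp add: \<sigma>_def inner_add_left)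
    ultimately show ?thesis by (simp only:) (simp add: algebra_simps)
  qed
  have pB: "1 - p \<bullet> B > 0" using disc_inner_less[OF p B] by simp
  \<comment> \<open>The segment stays inside the disc, so it ends before the parameter
    \<open>1 / F\<close> of \<open>B\<close>.\<close>
  have tF: "1 - t * F > 0" if "t \<in> {0..1}" for t
    using disc_inner_less[OF in_disc[OF that] B] gap[of t] pB
    by (metis diff_gt_0_iff_gt zero_less_mult_pos2)
  let ?\<phi> = "\<lambda>t. (q - p) \<bullet> B / (1 - \<sigma> t \<bullet> B)"
  have eq: "funk_metric (\<sigma> t) (vector_derivative \<sigma> (at t)) = ?\<phi> t" if t: "t \<in> {0..1}" for t
  proof -
    have "B - \<sigma> t = (1 - t * F) *\<^sub>R (B - p)"
      unfolding \<sigma>_def FB by (simp add: algebra_simps)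
    \<comment> \<open>Seen from \<open>\<sigma> t\<close> the velocity still points at
      \<open>B\<close>, so this factor is the Funk speed. It varies with \<open>t\<close>, but it is
      at each \<open>t\<close> the derivative of \<open>busemann B\<close> along the
      segment.\<close>
    then have "q - p = (F / (1 - t * F)) *\<^sub>R (B - \<sigma> t)"
      using tF[OF t] FB by simp
    then have "funk_metric (\<sigma> t) (q - p) = F / (1 - t * F)"
      using funk_metric_towards[OF in_disc[OF t] B, of "F / (1 - t * F)"] F tF[OF t]
      by (metis divide_nonneg_pos less_imp_le)
    also have "\<dots> = ?\<phi> t"
    proof -
      have "(q - p) \<bullet> B = F * (1 - p \<bullet> B)"
        using B unfolding FB by (simp add: inner_diff_left dot_square_norm)
      then show ?thesis using pB by (simp add: gap)
    qed
    finally show ?thesis by (simp add: vd')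
  qed
  have "(?\<phi> has_integral (busemann B (\<sigma> 1) - busemann B (\<sigma> 0))) {0..1}"
  proof (rule fundamental_theorem_of_calculus)
    show "((\<lambda>t. busemann B (\<sigma> t)) has_vector_derivative ?\<phi> t) (at t within {0..1})"
      if "t \<in> {0..1}" for t
      by (rule has_vector_derivative_at_within[OF busemann_has_derivative[OF vd in_disc[OF that] B]])
  qed simp
  moreover have "\<sigma> 0 = p" "\<sigma> 1 = q" by (simp_all add: \<sigma>_def)
  ultimately have "(?\<phi> has_integral (busemann B q - busemann B p)) {0..1}" by simp
  then have hi: "((\<lambda>t. funk_metric (\<sigma> t) (vector_derivative \<sigma> (at t))) has_integral
      (busemann B q - busemann B p)) {0..1}"
    by (rule has_integral_eq[rotated]) (use eq in simp)
  show ?thesis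
  proof
    show "\<sigma> piecewise_C1_differentiable_on {0..1}"
      by (intro C1_differentiable_imp_piecewise) (use vd in \<open>auto simp: C1_differentiable_on_def intro!: exI[of _ "\<lambda>_. q - p"]\<close>)
    show "finsler_length funk_metric \<sigma> 0 1 = busemann B q - busemann B p"
      unfolding finsler_length_def using hi by (rule integral_unique)
  qed (use B in_disc hi in \<open>auto simp: \<sigma>_def\<close>)
qed

text \<open>A minimizing curve has the length of a segment, so the calibration inequality
  \<open>funk_metric_ge\<close> is an equality along it.\<close>

lemma length_minimizing_funk_towards:
  assumes "a < b" "k > 0"
    and c: "\<And>t. t \<in> {a..b} \<Longrightarrow> c differentiable at t \<and> c t \<in> disc"
    and speed: "\<And>t. t \<in> {a..b} \<Longrightarrow> funk_metric (c t) (vector_derivative c (at t)) = k"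
    and min: "length_minimizing_on funk_metric disc c a b"
  obtains B where "norm B = 1"
    "\<And>t. t \<in> {a<..<b} \<Longrightarrow> vector_derivative c (at t) = k *\<^sub>R (B - c t)"
proof -
  have len: "finsler_length funk_metric c a b = k * (b - a)"
    by (rule finsler_length_constant_speed) (use speed assms(1) in auto)
  have ca: "c a \<in> disc" and cb: "c b \<in> disc" using c assms(1) by auto
  \<comment> \<open>\<open>funk_segment\<close> needs distinct points. If they coincided, the
    constant curve would be a competitor of length 0, while \<open>c\<close> has length
    \<open>k * (b - a) > 0\<close>.\<close>
  have "c a \<noteq> c b"
  proof
    assume "c a = c b"
    have z: "funk_metric (c a) 0 = 0" by (simp add: funk_metric_def)
    have "finsler_length funk_metric c a b \<le> finsler_length funk_metric (\<lambda>t. c a) 0 1"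
      by (rule min[unfolded length_minimizing_on_def, rule_format])
        (use ca \<open>c a = c b\<close> z in \<open>auto intro!: C1_differentiable_imp_piecewise\<close>)
    also have "\<dots> = 0" using z by (simp add: finsler_length_def)
    finally show False using len assms(1,2) by (simp add: mult_le_0_iff)
  qed
  then obtain B \<sigma> where B: "norm B = 1" and \<sigma>:
    "\<sigma> piecewise_C1_differentiable_on {0..1}" "\<sigma> ` {0..1} \<subseteq> disc" "\<sigma> 0 = c a" "\<sigma> 1 = c b"
    "(\<lambda>t. funk_metric (\<sigma> t) (vector_derivative \<sigma> (at t))) integrable_on {0..1}"
    "finsler_length funk_metric \<sigma> 0 1 = busemann B (c b) - busemann B (c a)"
    by (rule funk_segment[OF ca cb])
  have "finsler_length funk_metric c a b \<le> finsler_length funk_metric \<sigma> 0 1"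
    using min \<sigma>(1-5) unfolding length_minimizing_on_def by blast
  then have le: "k * (b - a) \<le> busemann B (c b) - busemann B (c a)"
    using len \<sigma>(6) by simp
  \<comment> \<open>\<open>h\<close> compares the length of \<open>c\<close> with the gain of
    \<open>busemann B\<close>. It is nondecreasing by the calibration inequality, and comparison
    with the segment gives \<open>h b \<le> h a\<close>, so it is constant.\<close>
  define h where "h t = k * t - busemann B (c t)" for t
  let ?\<phi> = "\<lambda>t. (vector_derivative c (at t) \<bullet> B) / (1 - c t \<bullet> B)"
  have dh: "(h has_real_derivative (k - ?\<phi> t)) (at t)" if "t \<in> {a..b}" for t
  proof -
    have "((\<lambda>t. busemann B (c t)) has_real_derivative ?\<phi> t) (at t)"
      using busemann_has_derivative[OF vector_derivative_works[THEN iffD1] _ B] c[OF that]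
      by (auto simp: has_real_derivative_iff_has_vector_derivative)
    then show ?thesis unfolding h_def by (auto intro!: derivative_eq_intros)
  qed
  have nonneg: "0 \<le> k - ?\<phi> t" if "t \<in> {a..b}" for t
    using funk_metric_ge[OF _ B] c[OF that] speed[OF that] by (metis diff_ge_0_iff_ge)
  have mono: "h s \<le> h t" if "s \<in> {a..b}" "t \<in> {a..b}" "s \<le> t" for s t
  proof (rule DERIV_nonneg_imp_nondecreasing[OF that(3)], intro exI conjI)
    fix x assume "s \<le> x" "x \<le> t"
    then have "x \<in> {a..b}" using that by simp
    then show "(h has_real_derivative (k - ?\<phi> x)) (at x)" "0 \<le> k - ?\<phi> x"
      using dh nonneg by blast+
  qed
  have "h b \<le> h a" using le by (simp add: h_def algebra_simps)
  then have const: "h t = h a" if "t \<in> {a..b}" for t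
    using mono[of a t] mono[of t b] that by force
  show ?thesis
  proof (rule that[OF B])
    fix t assume t: "t \<in> {a<..<b}"
    then have tab: "t \<in> {a..b}" by simp
    \<comment> \<open>At interior points constancy on the interval determines the two-sided
      derivative.\<close>
    have "((\<lambda>_. h a) has_real_derivative (k - ?\<phi> t)) (at t)"
      by (rule has_field_derivative_transform_within_open[OF dh[OF tab] open_greaterThanLessThan t])
        (auto intro!: const[symmetric] const)
    then have "k - ?\<phi> t = 0" by (rule DERIV_unique) (rule DERIV_const)
    then have "?\<phi> t = k" by simp
    then show "vector_derivative c (at t) = k *\<^sub>R (B - c t)"
      using funk_metric_ge_eqD[OF _ B, of "c t" "vector_derivative c (at t)"] c[of t] speed[of t] t
      by simp
  qed
qed

section \<open>Explicit geodesics and their maximal domains\<close>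

definition funk_curve :: "real \<Rightarrow> real^2 \<Rightarrow> real^2 \<Rightarrow> real \<Rightarrow> real^2" where
  "funk_curve k B C t = B + exp (- k * t) *\<^sub>R C"

lemma funk_curve_has_vector_derivative:
  "(funk_curve k B C has_vector_derivative k *\<^sub>R (B - funk_curve k B C t)) (at t)"
  unfolding funk_curve_def by (auto intro!: derivative_eq_intros simp: has_vector_derivative_def)

text \<open>Along the curve \<open>busemann B\<close> grows exactly at the speed \<open>k\<close>,
  so the length over a compact subinterval equals its increment there, which bounds every competitor
  from below.\<close>

lemma funk_curve_geodesic:
  assumes "open I" "is_interval I" "I \<noteq> {}" "k > 0" "norm B = 1" "funk_curve k B C ` I \<subseteq> disc"
  shows "finsler_geodesic funk_metric disc I (funk_curve k B C)"
proof -
  let ?c = "funk_curve k B C"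
  have in_disc: "?c t \<in> disc" if "t \<in> I" for t using assms(6) that by auto
  have vd: "vector_derivative ?c (at t) = k *\<^sub>R (B - ?c t)" for t
    by (rule vector_derivative_at[OF funk_curve_has_vector_derivative])
  have speed: "funk_metric (?c t) (vector_derivative ?c (at t)) = k" if "t \<in> I" for t
    unfolding vd using funk_metric_towards in_disc[OF that] assms by simp
  have "smooth_on I (\<lambda>t. B + exp ((-k) * t) *\<^sub>R C)"
    by (intro smooth_on_add smooth_on_scaleR smooth_on_const smooth_on_exp_scaled assms(1))
  moreover have "(\<lambda>t. B + exp ((-k) * t) *\<^sub>R C) = ?c" by (simp add: fun_eq_iff funk_curve_def)
  ultimately have "smooth_on I ?c" by simp
  moreover have "\<exists>\<epsilon>>0. {t - \<epsilon>..t + \<epsilon>} \<subseteq> I \<and> length_minimizing_on funk_metric disc ?c (t - \<epsilon>) (t + \<epsilon>)"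
    if t: "t \<in> I" for t
  proof -
    obtain \<epsilon> where e: "\<epsilon> > 0" "{t - \<epsilon>..t + \<epsilon>} \<subseteq> I"
      using assms(1) t unfolding open_contains_cball by (auto simp: cball_eq_atLeastAtMost)
    have "length_minimizing_on funk_metric disc ?c (t - \<epsilon>) (t + \<epsilon>)"
      unfolding length_minimizing_on_def
    proof (intro allI impI, elim conjE)
      fix \<sigma>
      assume \<sigma>: "\<sigma> piecewise_C1_differentiable_on {0..1}" "\<sigma> ` {0..1} \<subseteq> disc"
        "\<sigma> 0 = ?c (t - \<epsilon>)" "\<sigma> 1 = ?c (t + \<epsilon>)"
        "(\<lambda>t. funk_metric (\<sigma> t) (vector_derivative \<sigma> (at t))) integrable_on {0..1}"
      \<comment> \<open>The logarithm needs \<open>- (C \<bullet> B) > 0\<close>; this holds because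
        the curve lies in the disc at time \<open>s\<close>.\<close>
      have b: "busemann B (?c s) = k * s - ln (- (C \<bullet> B))" if "s \<in> I" for s
      proof -
        have eq: "1 - ?c s \<bullet> B = exp (- k * s) * (- (C \<bullet> B))"
          using assms(5) by (simp add: funk_curve_def inner_add_left dot_square_norm)
        moreover have "1 - ?c s \<bullet> B > 0"
          using disc_inner_less[OF in_disc[OF that] assms(5)] by simp
        ultimately have "- (C \<bullet> B) > 0" by (metis exp_gt_zero zero_less_mult_pos)
        then show ?thesis unfolding busemann_def eq by (subst ln_mult_pos) auto
      qed
      have "finsler_length funk_metric ?c (t - \<epsilon>) (t + \<epsilon>) = k * (t + \<epsilon> - (t - \<epsilon>))"
        by (rule finsler_length_constant_speed) (use speed e in auto)
      also have "\<dots> = busemann B (\<sigma> 1) - busemann B (\<sigma> 0)"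
      proof -
        have "t - \<epsilon> \<in> I" "t + \<epsilon> \<in> I" using e by auto
        then show ?thesis unfolding \<sigma>(3,4) by (simp add: b algebra_simps)
      qed
      also have "\<dots> \<le> finsler_length funk_metric \<sigma> 0 1"
        by (rule funk_length_ge_busemann[OF \<sigma>(1,2,5) assms(5)])
      finally show "finsler_length funk_metric ?c (t - \<epsilon>) (t + \<epsilon>) \<le> finsler_length funk_metric \<sigma> 0 1" .
    qed
    with e show ?thesis by blast
  qed
  ultimately show ?thesis
    unfolding finsler_geodesic_def using assms speed by blast
qed

lemma funk_geodesic_imp_curve:
  assumes geo: "finsler_geodesic funk_metric disc I c"
  obtains k B C where "k > 0" "norm B = 1" "\<And>t. t \<in> I \<Longrightarrow> c t = funk_curve k B C t"
proof -
  obtain k where I: "open I" "is_interval I" "I \<noteq> {}" and sm: "smooth_on I c" and cM: "c ` I \<subseteq> disc"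
    and k: "k > 0" and sp: "\<And>t. t \<in> I \<Longrightarrow> funk_metric (c t) (vector_derivative c (at t)) = k"
    and min: "\<forall>t\<in>I. \<exists>\<epsilon>>0. {t - \<epsilon>..t + \<epsilon>} \<subseteq> I \<and> length_minimizing_on funk_metric disc c (t - \<epsilon>) (t + \<epsilon>)"
    using geo unfolding finsler_geodesic_def by blast
  have diff: "c differentiable at t" "c t \<in> disc" if "t \<in> I" for t
    using smooth_on_imp_differentiable[OF sm that] cM that by auto
  \<comment> \<open>\<open>E t\<close> is the point at which the tangent ray of \<open>c\<close>
    meets the unit circle. Minimality makes it locally constant, and connectedness of
    \<open>I\<close> makes it constant.\<close>
  define E where "E t = c t + (1 / k) *\<^sub>R vector_derivative c (at t)" for t
  have local: "\<exists>B \<epsilon>. \<epsilon> > 0 \<and> norm B = 1 \<and> (\<forall>s\<in>{t - \<epsilon><..<t + \<epsilon>}. E s = B)" if t: "t \<in> I" for t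
  proof -
    obtain \<epsilon> where e: "\<epsilon> > 0" "{t - \<epsilon>..t + \<epsilon>} \<subseteq> I" "length_minimizing_on funk_metric disc c (t - \<epsilon>) (t + \<epsilon>)"
      using min t by blast
    obtain B where B: "norm B = 1"
      "\<And>s. s \<in> {t - \<epsilon><..<t + \<epsilon>} \<Longrightarrow> vector_derivative c (at s) = k *\<^sub>R (B - c s)"
      by (rule length_minimizing_funk_towards[of "t - \<epsilon>" "t + \<epsilon>" k c])
        (use e k diff sp in \<open>auto simp: subset_iff\<close>)
    then have "E s = B" if "s \<in> {t - \<epsilon><..<t + \<epsilon>}" for s
      using k that by (simp add: E_def)
    then show ?thesis using e(1) B(1) by blast
  qed
  obtain t0 where t0: "t0 \<in> I" using I(3) by blast
  define B where "B = E t0"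
  have EB: "E t = B" if "t \<in> I" for t
    unfolding B_def
  proof (rule connected_local_const[where A = I])
    show "\<forall>a\<in>I. eventually (\<lambda>b. E a = E b) (at a within I)"
    proof
      fix a assume "a \<in> I"
      then obtain B' \<epsilon> where *: "\<epsilon> > 0" "\<forall>s\<in>{a - \<epsilon><..<a + \<epsilon>}. E s = B'" using local by blast
      then have "\<forall>x\<in>I. x \<noteq> a \<and> dist x a < \<epsilon> \<longrightarrow> E a = E x"
        by (auto simp: dist_real_def abs_less_iff)
      then show "eventually (\<lambda>b. E a = E b) (at a within I)"
        unfolding eventually_at using *(1) by blast
    qed
  qed (use I(2) is_interval_connected that t0 in auto)
  have B: "norm B = 1"
    using local[OF t0] by (auto simp: B_def)
  have vd: "(c has_vector_derivative k *\<^sub>R (B - c t)) (at t)" if "t \<in> I" for t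
  proof -
    have "vector_derivative c (at t) = k *\<^sub>R (B - c t)"
      using EB[OF that] k by (auto simp: E_def)
    then show ?thesis using diff(1)[OF that] vector_derivative_works by metis
  qed
  \<comment> \<open>Integrating factor for the equation \<open>c' = k (B - c)\<close>; the constant
    value of \<open>g\<close> is the parameter \<open>C\<close>.\<close>
  define g where "g t = exp (k * t) *\<^sub>R (c t - B)" for t
  have dg: "(g has_vector_derivative 0) (at t)" if "t \<in> I" for t
    unfolding g_def
    by (auto intro!: derivative_eq_intros vd[OF that] simp: algebra_simps has_real_derivative_iff_has_vector_derivative)
  have gconst: "g t = g t0" if "t \<in> I" for t
    by (rule has_derivative_zero_unique_connected[OF I(1) _ _ that])
      (use dg I(2) t0 is_interval_connected in \<open>auto simp: has_vector_derivative_def\<close>)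
  have "c t = funk_curve k B (g t0) t" if "t \<in> I" for t
    unfolding funk_curve_def gconst[OF that, symmetric] by (simp add: g_def mult_exp_exp)
  then show ?thesis using k B that by blast
qed

text \<open>Since \<open>norm B = 1\<close>, the constant term of \<open>|B + s C|^2 - 1\<close>
  vanishes and a factor \<open>s\<close> splits off.\<close>

lemma chord_point_in_disc_iff:
  fixes B C :: "real^2"
  assumes "norm B = 1"
  shows "B + s *\<^sub>R C \<in> disc \<longleftrightarrow> s * (2 * (B \<bullet> C) + s * (norm C)\<^sup>2) < 0"
proof -
  have "B + s *\<^sub>R C \<in> disc \<longleftrightarrow> (norm (B + s *\<^sub>R C))\<^sup>2 < 1"
    by (simp add: disc_def power_less_one_iff)
  also have "(norm (B + s *\<^sub>R C))\<^sup>2 = 1 + s * (2 * (B \<bullet> C) + s * (norm C)\<^sup>2)"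
  proof -
    have "B \<bullet> B = 1" using assms by (simp add: dot_square_norm)
    then show ?thesis
      unfolding power2_norm_eq_inner
      by (simp add: inner_add_left inner_add_right inner_commute algebra_simps)
  qed
  finally show ?thesis by simp
qed

lemma funk_curve_in_disc_iff:
  assumes "norm B = 1"
  shows "funk_curve k B C t \<in> disc \<longleftrightarrow> exp (- k * t) * (norm C)\<^sup>2 < - 2 * (B \<bullet> C)"
proof -
  have "funk_curve k B C t \<in> disc \<longleftrightarrow> 2 * (B \<bullet> C) + exp (- k * t) * (norm C)\<^sup>2 < 0"
    unfolding funk_curve_def chord_point_in_disc_iff[OF assms] by (simp add: mult_less_0_iff)
  then show ?thesis by linarith
qed

text \<open>\<open>exp (- k * t)\<close> decreases, so a curve that is in the disc stays in it: the
  set of times is closed under passing to later ones.\<close>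

lemma funk_curve_domain:
  assumes "norm B = 1" "k > 0"
  shows "open {t. funk_curve k B C t \<in> disc}" "is_interval {t. funk_curve k B C t \<in> disc}"
proof -
  have "continuous_on UNIV (funk_curve k B C)"
    unfolding funk_curve_def by (intro continuous_intros)
  then have "open (funk_curve k B C -` disc)" using open_disc by (rule open_vimage[rotated])
  then show "open {t. funk_curve k B C t \<in> disc}" by (simp add: vimage_def)
  show "is_interval {t. funk_curve k B C t \<in> disc}"
    unfolding is_interval_1 mem_Collect_eq funk_curve_in_disc_iff[OF assms(1)]
  proof (intro ballI allI impI, elim conjE, unfold mem_Collect_eq)
    fix a b x :: real
    assume "exp (- k * a) * (norm C)\<^sup>2 < - 2 * (B \<bullet> C)" "a \<le> x"
    moreover have "exp (- k * x) * (norm C)\<^sup>2 \<le> exp (- k * a) * (norm C)\<^sup>2"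
      using \<open>a \<le> x\<close> assms(2) by (intro mult_right_mono) auto
    ultimately show "exp (- k * x) * (norm C)\<^sup>2 < - 2 * (B \<bullet> C)" by linarith
  qed
qed

text \<open>Agreement on an open set gives equal velocities at \<open>t\<close>. Their Funk length
  is \<open>k\<close>, their direction then gives \<open>B\<close>, and the common position gives
  \<open>C\<close>.\<close>

lemma funk_curve_unique:
  assumes "open I" "t \<in> I" "k > 0" "k' > 0" "norm B = 1" "norm B' = 1"
    and eq: "\<And>s. s \<in> I \<Longrightarrow> funk_curve k' B' C' s = funk_curve k B C s"
    and in_disc: "funk_curve k B C t \<in> disc"
  shows "k' = k \<and> B' = B \<and> C' = C"
proof -
  let ?x = "funk_curve k B C t"
  have x: "funk_curve k' B' C' t = ?x" using eq assms(2) .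
  have "(funk_curve k B C has_vector_derivative k' *\<^sub>R (B' - ?x)) (at t)"
    using has_vector_derivative_transform_within_open[OF funk_curve_has_vector_derivative assms(1,2) eq]
    by (simp add: x)
  then have v: "k' *\<^sub>R (B' - ?x) = k *\<^sub>R (B - ?x)"
    using funk_curve_has_vector_derivative vector_derivative_unique_at by blast
  have k: "k' = k"
    using funk_metric_towards[OF in_disc, of B k] funk_metric_towards[OF in_disc, of B' k'] v assms
    by simp
  then have "B' = B" using v assms(3) by simp
  then show ?thesis using x k by (simp add: funk_curve_def)
qed

text \<open>Every geodesic is a restriction of some \<open>funk_curve\<close>, and a maximal one
  must fill the whole domain of that curve. Conversely, an extension agrees with the curve on the
  open set \<open>I\<close>, so it has the same parameters and cannot leave the disc.\<close>

lemma maximal_funk_geodesic_iff: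
  "maximal_geodesic funk_metric disc I c \<longleftrightarrow>
    (\<exists>k>0. \<exists>B C. norm B = 1 \<and> I = {t. funk_curve k B C t \<in> disc} \<and> I \<noteq> {} \<and>
      (\<forall>t\<in>I. c t = funk_curve k B C t))"
proof
  assume max: "maximal_geodesic funk_metric disc I c"
  then have geo: "finsler_geodesic funk_metric disc I c"
    by (simp add: maximal_geodesic_def)
  obtain k B C where k: "k > 0" and B: "norm B = 1"
    and c: "\<And>t. t \<in> I \<Longrightarrow> c t = funk_curve k B C t"
    using funk_geodesic_imp_curve[OF geo] by metis
  let ?J = "{t. funk_curve k B C t \<in> disc}"
  have I: "I \<noteq> {}" "c ` I \<subseteq> disc" using geo by (auto simp: finsler_geodesic_def)
  then have IJ: "I \<subseteq> ?J" using c by auto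
  have "finsler_geodesic funk_metric disc ?J (funk_curve k B C)"
    by (rule funk_curve_geodesic) (use funk_curve_domain[OF B k] k B I IJ in auto)
  then have "?J = I"
    using max IJ c unfolding maximal_geodesic_def by metis
  then show "\<exists>k>0. \<exists>B C. norm B = 1 \<and> I = {t. funk_curve k B C t \<in> disc} \<and> I \<noteq> {} \<and>
      (\<forall>t\<in>I. c t = funk_curve k B C t)"
    using k B I c by blast
next
  assume "\<exists>k>0. \<exists>B C. norm B = 1 \<and> I = {t. funk_curve k B C t \<in> disc} \<and> I \<noteq> {} \<and>
      (\<forall>t\<in>I. c t = funk_curve k B C t)"
  then obtain k B C where k: "k > 0" and B: "norm B = 1" and I: "I = {t. funk_curve k B C t \<in> disc}"
    "I \<noteq> {}" and c: "\<And>t. t \<in> I \<Longrightarrow> c t = funk_curve k B C t" by blast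
  have opI: "open I" "is_interval I" using funk_curve_domain[OF B k] I(1) by auto
  have geo: "finsler_geodesic funk_metric disc I c"
    by (rule finsler_geodesic_cong[OF funk_curve_geodesic[OF opI I(2) k B]]) (use I(1) c in auto)
  obtain t where t: "t \<in> I" using I(2) by blast
  have "J = I" if J: "finsler_geodesic funk_metric disc J d" "I \<subseteq> J" "\<forall>t\<in>I. d t = c t" for J d
  proof -
    obtain k' B' C' where d: "k' > 0" "norm B' = 1" "\<And>t. t \<in> J \<Longrightarrow> d t = funk_curve k' B' C' t"
      using funk_geodesic_imp_curve[OF J(1)] by metis
    have "k' = k \<and> B' = B \<and> C' = C"
    proof (rule funk_curve_unique[OF opI(1) t k d(1) B d(2)])
      show "funk_curve k' B' C' s = funk_curve k B C s" if "s \<in> I" for s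
        using J(2,3) d(3)[of s] c[of s] that by auto
    qed (use t I(1) in auto)
    then have "J \<subseteq> I"
      using J(1) d(3) I(1) unfolding finsler_geodesic_def by auto
    then show ?thesis using J(2) by blast
  qed
  then show "maximal_geodesic funk_metric disc I c"
    unfolding maximal_geodesic_def using geo by blast
qed

section \<open>Funk geodesics as chords\<close>

lemma line_through_two_points:
  fixes l :: "'a::euclidean_space set"
  assumes "affine l" "aff_dim l = 1" "a \<in> l" "b \<in> l" "a \<noteq> b"
  shows "l = range (\<lambda>s. a + s *\<^sub>R (b - a))"
proof -
  have "affine hull {a, b} \<subseteq> l" using assms by (intro hull_minimal) auto
  moreover have "aff_dim (affine hull {a, b}) = aff_dim l"
    using assms by (simp add: aff_dim_2)
  ultimately have "affine hull {a, b} = l"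
    using assms(1) by (intro affine_dim_equal) auto
  then show ?thesis by (simp add: affine_hull_2_alt)
qed

text \<open>The curve covers the parameters \<open>s = exp (- k * t) > 0\<close> of the line. No
  point of the disc is lost: \<open>B \<bullet> C < 0\<close>, so for \<open>s \<le> 0\<close> the
  product in \<open>chord_point_in_disc_iff\<close> is nonnegative.\<close>

lemma funk_curve_image:
  assumes "norm B = 1" "k > 0" "funk_curve k B C t0 \<in> disc"
  shows "funk_curve k B C ` {t. funk_curve k B C t \<in> disc} = range (\<lambda>s. B + s *\<^sub>R C) \<inter> disc"
proof (intro equalityI subsetI)
  fix x assume "x \<in> range (\<lambda>s. B + s *\<^sub>R C) \<inter> disc"
  then obtain s where s: "x = B + s *\<^sub>R C" "x \<in> disc" by auto
  have "0 \<le> exp (- k * t0) * (norm C)\<^sup>2" by simp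
  then have BC: "B \<bullet> C < 0" using assms(3) funk_curve_in_disc_iff[OF assms(1)] by (smt (verit))
  have "s * (2 * (B \<bullet> C) + s * (norm C)\<^sup>2) < 0"
    using s chord_point_in_disc_iff[OF assms(1)] by simp
  moreover have "s * (2 * (B \<bullet> C) + s * (norm C)\<^sup>2) \<ge> 0" if "s \<le> 0"
    using that BC by (intro mult_nonpos_nonpos) (simp_all add: add_nonpos_nonpos mult_nonpos_nonneg)
  ultimately have "s > 0" by linarith
  then have "x = funk_curve k B C (- ln s / k)"
    using assms(2) s by (simp add: funk_curve_def)
  then show "x \<in> funk_curve k B C ` {t. funk_curve k B C t \<in> disc}" using s(2) by blast
qed (auto simp: funk_curve_def)

lemma funk_geodesic_trajectories:
  "geodesic_trajectories funk_metric disc = {l \<inter> disc | l. l \<in> chord_lines}"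
proof (intro equalityI subsetI)
  fix A assume "A \<in> geodesic_trajectories funk_metric disc"
  then obtain I c where "maximal_geodesic funk_metric disc I c" and Ac: "A = c ` I"
    unfolding geodesic_trajectories_def by blast
  then obtain k B C where k: "k > 0" and B: "norm B = 1"
    and I: "I = {t. funk_curve k B C t \<in> disc}" "I \<noteq> {}"
    and c: "\<And>t. t \<in> I \<Longrightarrow> c t = funk_curve k B C t"
    unfolding maximal_funk_geodesic_iff by blast
  have A: "A = funk_curve k B C ` I" unfolding Ac using c by (rule image_cong[OF refl])
  obtain t0 where t0: "funk_curve k B C t0 \<in> disc" using I by auto
  let ?l = "range (\<lambda>s. B + s *\<^sub>R C)"
  have Al: "A = ?l \<inter> disc"
    unfolding A I(1) by (rule funk_curve_image[OF B k t0])
  \<comment> \<open>With \<open>C = 0\<close> the curve would rest at \<open>B\<close>, outside the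
    open disc.\<close>
  have "C \<noteq> 0" using t0 B by (auto simp: funk_curve_def disc_def)
  moreover have l: "?l = affine hull {B, B + C}" by (simp add: affine_hull_2_alt)
  ultimately have "affine ?l \<and> aff_dim ?l = 1"
    unfolding l by (simp add: aff_dim_2)
  moreover have "?l \<inter> disc \<noteq> {}" using Al A I(2) by auto
  ultimately show "A \<in> {l \<inter> disc | l. l \<in> chord_lines}"
    unfolding chord_lines_def using Al by blast
next
  fix A assume "A \<in> {l \<inter> disc | l. l \<in> chord_lines}"
  then obtain l p where l: "affine l" "aff_dim l = 1" and A: "A = l \<inter> disc" and p: "p \<in> l" "p \<in> disc"
    unfolding chord_lines_def by blast
  have "l \<noteq> {p}" using l(2) by auto
  then obtain q where q: "q \<in> l" "p \<noteq> q" using p by blast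
  define F where "F = funk_metric p (q - p)"
  \<comment> \<open>As in \<open>funk_segment\<close>, this is where the ray from \<open>p\<close>
    through \<open>q\<close> leaves the disc. The curve with \<open>k = 1\<close> and
    \<open>C = p - B\<close> is at \<open>p\<close> at time 0 and heads for
    \<open>B\<close>.\<close>
  define B where "B = p + (1 / F) *\<^sub>R (q - p)"
  have F: "F > 0" unfolding F_def using funk_metric_pos[OF p(2)] q by simp
  have "norm (F *\<^sub>R B) = F"
    using funk_metric_norm[OF p(2), of "q - p"] F by (simp add: B_def F_def[symmetric] scaleR_add_right)
  then have B: "norm B = 1" using F by simp
  have "B \<in> l" unfolding line_through_two_points[OF l p(1) q] B_def by blast
  moreover have "B \<noteq> p" using B p(2) by (auto simp: disc_def)
  ultimately have l': "l = range (\<lambda>s. B + s *\<^sub>R (p - B))"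
    by (intro line_through_two_points[OF l _ p(1)])
  have 0: "funk_curve 1 B (p - B) 0 \<in> disc" using p(2) by (simp add: funk_curve_def)
  let ?I = "{t. funk_curve 1 B (p - B) t \<in> disc}"
  have "maximal_geodesic funk_metric disc ?I (funk_curve 1 B (p - B))"
    unfolding maximal_funk_geodesic_iff using B 0 by (intro exI[of _ 1] conjI exI[of _ B] exI[of _ "p - B"]) auto
  moreover have "A = funk_curve 1 B (p - B) ` ?I"
    using funk_curve_image[OF B _ 0] l' A by simp
  ultimately show "A \<in> geodesic_trajectories funk_metric disc"
    unfolding geodesic_trajectories_def by blast
qed

section \<open>The isometry onto the upper half plane\<close>

lemma open_upper_half_plane: "open upper_half_plane"
proof -
  have "upper_half_plane = (\<lambda>x. x$2) -` {0<..}" by (auto simp: upper_half_plane_def)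
  moreover have "open ((\<lambda>x::real^2. x$2) -` {0<..})"
    by (auto intro!: open_vimage continuous_intros)
  ultimately show ?thesis by simp
qed

lemma norm_sq_2: "(norm (x::real^2))\<^sup>2 = (x$1)\<^sup>2 + (x$2)\<^sup>2"
  by (subst power2_norm_eq_inner) (simp only: inner_vec_def sum_2 inner_real_def power2_eq_square)

lemma inner_2: "(x::real^2) \<bullet> y = x$1 * y$1 + x$2 * y$2"
  by (simp add: inner_vec_def sum_2)

lemma vec_eq_2: "(x::real^2) = y \<longleftrightarrow> x$1 = y$1 \<and> x$2 = y$2"
  by (simp add: vec_eq_iff forall_2)

lemma vector_2_axis: "(vector [a, b] :: real^2) = a *\<^sub>R axis 1 1 + b *\<^sub>R axis 2 1"
  by (simp add: vec_eq_2 axis_def)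

lemma in_disc_iff: "x \<in> disc \<longleftrightarrow> (x$1)\<^sup>2 + (x$2)\<^sup>2 < 1"
  using norm_sq_2[of x] by (simp add: disc_def power_less_one_iff flip: norm_sq_2)

lemma disc_first_coordinate:
  assumes "x \<in> disc" shows "1 + x$1 > 0"
proof -
  have "(x$1)\<^sup>2 < 1" using assms in_disc_iff[of x] by (smt (verit) zero_le_power2)
  then show ?thesis by (simp add: abs_square_less_1 abs_less_iff)
qed

text \<open>The inverse of \<open>funk_to_fp\<close>: \<open>4 + |y|^2 = 8 / (1 + x_1)\<close> is
  solved for \<open>x_1\<close>, and then \<open>y_1 = 2 x_2 / (1 + x_1)\<close> for
  \<open>x_2\<close>.\<close>

definition fp_to_funk :: "real^2 \<Rightarrow> real^2" where
  "fp_to_funk y = vector [(4 - (norm y)\<^sup>2) / (4 + (norm y)\<^sup>2), 4 * y$1 / (4 + (norm y)\<^sup>2)]"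

text \<open>Inserting \<open>1 - |x|^2 = 1 - (s - 1)^2 - x_2^2\<close> cancels all squares in the
  numerator and leaves \<open>8 s\<close>. Both the inversion and the comparison of metrics rest on
  this value.\<close>

lemma funk_to_fp_norm_sq:
  assumes "x \<in> disc" shows "4 + (norm (funk_to_fp x))\<^sup>2 = 8 / (1 + x$1)"
proof -
  define s where "s = 1 + x$1"
  have s: "s > 0" unfolding s_def by (rule disc_first_coordinate[OF assms])
  have w: "(sqrt (1 - (norm x)\<^sup>2))\<^sup>2 = 1 - (s - 1)\<^sup>2 - (x$2)\<^sup>2"
    using disc_norm_sq[OF assms] by (simp add: norm_sq_2 s_def)
  have "4 + (norm (funk_to_fp x))\<^sup>2 =
      (4 * s\<^sup>2 + 4 * (x$2)\<^sup>2 + 4 * (sqrt (1 - (norm x)\<^sup>2))\<^sup>2) / s\<^sup>2"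
    unfolding norm_sq_2[of "funk_to_fp x"] using s
    by (simp add: funk_to_fp_def s_def[symmetric] power_divide power_mult_distrib add_divide_distrib)
  also have "\<dots> = (8 * s) / s\<^sup>2"
    unfolding w by (simp add: power2_eq_square algebra_simps)
  also have "\<dots> = 8 / s" using s by (simp add: power2_eq_square)
  finally show ?thesis by (simp only: s_def)
qed

lemma funk_to_fp_in:
  assumes "x \<in> disc" shows "funk_to_fp x \<in> upper_half_plane"
  using disc_first_coordinate[OF assms] disc_norm_sq[OF assms]
  by (simp add: upper_half_plane_def funk_to_fp_def)

lemma fp_to_funk_funk_to_fp:
  assumes "x \<in> disc" shows "fp_to_funk (funk_to_fp x) = x"
proof -
  define s n where "s = 1 + x$1" and "n = (norm (funk_to_fp x))\<^sup>2"
  have s: "s > 0" unfolding s_def by (rule disc_first_coordinate[OF assms])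
  have n: "4 + n = 8 / s" unfolding s_def n_def by (rule funk_to_fp_norm_sq[OF assms])
  then have n': "4 - n = 8 - 8 / s" by linarith
  have "(4 - n) / (4 + n) = s - 1"
    unfolding n n' using s by (simp add: field_simps)
  then have "(4 - n) / (4 + n) = x$1" by (simp add: s_def)
  moreover have "4 * funk_to_fp x $ 1 / (4 + n) = x$2"
    unfolding n using s by (simp add: funk_to_fp_def s_def[symmetric])
  ultimately show ?thesis
    by (simp add: fp_to_funk_def n_def[symmetric] vec_eq_2)
qed

text \<open>Rests on \<open>(4 + n)^2 - (4 - n)^2 = 16 n\<close>. Positivity of the right-hand side
  puts the image in the disc, and its being a square resolves the root in
  \<open>funk_to_fp\<close>.\<close>

lemma fp_to_funk_norm_sq:
  "1 - (norm (fp_to_funk y))\<^sup>2 = 16 * (y$2)\<^sup>2 / (4 + (norm y)\<^sup>2)\<^sup>2"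
proof -
  define n where "n = (norm y)\<^sup>2"
  have n: "4 + n \<noteq> 0" using zero_le_power2[of "norm y"] unfolding n_def by linarith
  have y: "(y$2)\<^sup>2 = n - (y$1)\<^sup>2" by (simp add: n_def norm_sq_2)
  have "(norm (fp_to_funk y))\<^sup>2 = (4 - n)\<^sup>2 / (4 + n)\<^sup>2 + 16 * (y$1)\<^sup>2 / (4 + n)\<^sup>2"
    unfolding norm_sq_2[of "fp_to_funk y"]
    by (simp add: fp_to_funk_def n_def[symmetric] power_divide power_mult_distrib)
  moreover have "1 = (4 + n)\<^sup>2 / (4 + n)\<^sup>2" using n by simp
  ultimately have "1 - (norm (fp_to_funk y))\<^sup>2
      = ((4 + n)\<^sup>2 - (4 - n)\<^sup>2 - 16 * (y$1)\<^sup>2) / (4 + n)\<^sup>2"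
    by (simp only: diff_divide_distrib)
  also have "(4 + n)\<^sup>2 - (4 - n)\<^sup>2 - 16 * (y$1)\<^sup>2 = 16 * (y$2)\<^sup>2"
    unfolding y by (simp add: power2_eq_square algebra_simps)
  finally show ?thesis by (simp add: n_def)
qed

lemma norm_sq_plus_4: "4 + (norm (y::'a::real_normed_vector))\<^sup>2 > 0"
  by (simp add: add_pos_nonneg)

lemma fp_to_funk_in:
  assumes "y \<in> upper_half_plane" shows "fp_to_funk y \<in> disc"
proof -
  have "y$2 > 0" using assms by (simp add: upper_half_plane_def)
  then have "16 * (y$2)\<^sup>2 / (4 + (norm y)\<^sup>2)\<^sup>2 > 0"
    using norm_sq_plus_4[of y] by (intro divide_pos_pos zero_less_power mult_pos_pos) auto
  then have "(norm (fp_to_funk y))\<^sup>2 < 1" using fp_to_funk_norm_sq[of y] by linarith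
  then show ?thesis by (simp add: disc_def power_less_one_iff)
qed

lemma funk_to_fp_fp_to_funk:
  assumes "y \<in> upper_half_plane" shows "funk_to_fp (fp_to_funk y) = y"
proof -
  have y: "y$2 > 0" using assms by (simp add: upper_half_plane_def)
  define m where "m = 4 + (norm y)\<^sup>2"
  have m: "m > 0" unfolding m_def by (rule norm_sq_plus_4)
  have s: "1 + fp_to_funk y $ 1 = 8 / m"
  proof -
    have "1 + fp_to_funk y $ 1 = (m + (4 - (norm y)\<^sup>2)) / m"
      using m by (simp add: fp_to_funk_def m_def[symmetric] add_divide_distrib)
    then show ?thesis by (simp add: m_def)
  qed
  have "sqrt (1 - (norm (fp_to_funk y))\<^sup>2) = sqrt ((4 * y$2 / m)\<^sup>2)"
    unfolding fp_to_funk_norm_sq m_def by (simp add: power_divide power_mult_distrib)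
  then have w: "sqrt (1 - (norm (fp_to_funk y))\<^sup>2) = 4 * y$2 / m"
    using y m by simp
  show ?thesis
    unfolding funk_to_fp_def s w using m
    by (simp add: vec_eq_2 fp_to_funk_def m_def[symmetric])
qed

lemma funk_to_fp_bij: "bij_betw funk_to_fp disc upper_half_plane"
  by (rule bij_betwI[where g = fp_to_funk])
    (auto simp: funk_to_fp_in fp_to_funk_in fp_to_funk_funk_to_fp funk_to_fp_fp_to_funk)

section \<open>Smoothness of the map and of its inverse\<close>

lemma smooth_on_coordinate: "open S \<Longrightarrow> smooth_on S (\<lambda>x::real^2. x $ i)"
  by (rule smooth_on_bounded_linear) (simp_all add: bounded_linear_vec_nth)

lemma smooth_on_norm_sq:
  "open S \<Longrightarrow> smooth_on S (\<lambda>x::real^2. (norm x)\<^sup>2)"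
  unfolding power2_norm_eq_inner
  by (intro smooth_on_inner smooth_on_bounded_linear) (simp_all add: bounded_linear_ident)

lemma smooth_on_diff_real:
  assumes "open S" "smooth_on S f" "smooth_on S (g :: _ \<Rightarrow> real)"
  shows "smooth_on S (\<lambda>x. f x - g x)"
  using smooth_on_add[OF assms(1,2) smooth_on_mult[OF assms(1) smooth_on_const[OF assms(1), of "-1"] assms(3)]]
  by simp

lemma smooth_on_vector_2:
  "open S \<Longrightarrow> smooth_on S f \<Longrightarrow> smooth_on S g \<Longrightarrow> smooth_on S (\<lambda>x. vector [f x, g x] :: real^2)"
  unfolding vector_2_axis by (intro smooth_on_add smooth_on_scaleR smooth_on_const)

lemma smooth_on_funk_to_fp: "smooth_on disc funk_to_fp"
proof -
  have pos: "1 - (norm x)\<^sup>2 > 0" "1 + x$1 > 0" if "x \<in> disc" for x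
    using disc_norm_sq[OF that] disc_first_coordinate[OF that] by auto
  have "smooth_on disc (\<lambda>x. vector [2 * x$2 / (1 + x$1), 2 * sqrt (1 - (norm x)\<^sup>2) / (1 + x$1)] :: real^2)"
    by (intro smooth_on_vector_2 smooth_on_divide smooth_on_mult smooth_on_const smooth_on_add
        smooth_on_sqrt smooth_on_diff_real smooth_on_norm_sq smooth_on_coordinate open_disc pos)
  then show ?thesis by (simp add: funk_to_fp_def[abs_def])
qed

lemma smooth_on_fp_to_funk: "smooth_on upper_half_plane fp_to_funk"
proof -
  have "smooth_on upper_half_plane (\<lambda>y. vector [(4 - (norm y)\<^sup>2) / (4 + (norm y)\<^sup>2),
      4 * y$1 / (4 + (norm y)\<^sup>2)] :: real^2)"
    by (intro smooth_on_vector_2 smooth_on_divide smooth_on_mult smooth_on_const smooth_on_add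
        smooth_on_diff_real smooth_on_norm_sq smooth_on_coordinate open_upper_half_plane norm_sq_plus_4)
  then show ?thesis by (simp add: fp_to_funk_def[abs_def])
qed

section \<open>The derivative and the two metrics\<close>

lemma funk_to_fp_has_derivative:
  assumes "x \<in> disc"
  defines "s \<equiv> 1 + x$1" and "w \<equiv> sqrt (1 - (norm x)\<^sup>2)"
  shows "(funk_to_fp has_derivative (\<lambda>v. vector
      [2 * (v$2 * s - x$2 * v$1) / s\<^sup>2, - 2 * ((x \<bullet> v) * s + w\<^sup>2 * v$1) / (w * s\<^sup>2)])) (at x)"
proof -
  have s: "s > 0" unfolding s_def by (rule disc_first_coordinate[OF assms(1)])
  have pos: "1 - x \<bullet> x > 0" using disc_norm_sq[OF assms(1)] by (simp add: power2_norm_eq_inner)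
  have w: "w = sqrt (1 - x \<bullet> x)" "w > 0" using pos by (simp_all add: w_def power2_norm_eq_inner)
  have coord: "((\<lambda>x::real^2. x $ i) has_derivative (\<lambda>v. v $ i)) (at x)" for i
    by (rule bounded_linear_imp_has_derivative[OF bounded_linear_vec_nth])
  have s': "((\<lambda>x::real^2. 1 + x$1) has_derivative (\<lambda>v. v$1)) (at x)"
    by (auto intro!: derivative_eq_intros coord)
  have n': "((\<lambda>x::real^2. 2 * sqrt (1 - x \<bullet> x)) has_derivative (\<lambda>v. - 2 * (x \<bullet> v) / w)) (at x)"
    using pos unfolding w(1)
    by (auto intro!: derivative_eq_intros simp: inner_commute field_simps)
  have 1: "((\<lambda>x::real^2. 2 * x$2 / (1 + x$1)) has_derivative
      (\<lambda>v. 2 * (v$2 * s - x$2 * v$1) / s\<^sup>2)) (at x)"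
    by (rule has_derivative_eq_rhs[OF has_derivative_divide'[OF _ s']])
      (use s in \<open>auto intro!: derivative_eq_intros coord simp: s_def[symmetric] fun_eq_iff power2_eq_square algebra_simps\<close>)
  have 2: "((\<lambda>x::real^2. 2 * sqrt (1 - x \<bullet> x) / (1 + x$1)) has_derivative
      (\<lambda>v. - 2 * ((x \<bullet> v) * s + w\<^sup>2 * v$1) / (w * s\<^sup>2))) (at x)"
    by (rule has_derivative_eq_rhs[OF has_derivative_divide'[OF n' s']])
      (use s w(2) in \<open>auto simp: s_def[symmetric] w(1)[symmetric] fun_eq_iff power2_eq_square field_simps\<close>)
  show ?thesis
    unfolding funk_to_fp_def[abs_def] vector_2_axis power2_norm_eq_inner
    by (intro has_derivative_add has_derivative_scaleR_left 1 2)
qed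

text \<open>The one-form in \<^const>\<open>fp_metric\<close> is the differential of \<open>ln ((4 + |y|\<^sup>2) / y\<^sub>2)\<close>;
  \<open>4 + |y|\<^sup>2 = 8 / (1 + x\<^sub>1)\<close> makes this function \<open>ln 4 - ln (1 - |x|\<^sup>2) / 2\<close> on the disc, and the
  remaining term is the hyperbolic metric in the Klein model.\<close>

lemma funk_to_fp_isometric:
  assumes "x \<in> disc"
  shows "fp_metric (funk_to_fp x) (frechet_derivative funk_to_fp (at x) v) = funk_metric x v"
proof -
  define s where "s = 1 + x$1"
  define w where "w = sqrt (1 - (norm x)\<^sup>2)"
  define p where "p = x \<bullet> v"
  define V1 where "V1 = 2 * (v$2 * s - x$2 * v$1) / s\<^sup>2"
  define V2 where "V2 = - 2 * (p * s + w\<^sup>2 * v$1) / (w * s\<^sup>2)"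
  define y1 where "y1 = 2 * x$2 / s"
  define y2 where "y2 = 2 * w / s"
  have s: "s > 0" unfolding s_def by (rule disc_first_coordinate[OF assms])
  have w: "w > 0" using disc_norm_sq[OF assms] by (simp add: w_def)
  have w2: "w\<^sup>2 = 1 - (norm x)\<^sup>2" using disc_norm_sq[OF assms] by (simp add: w_def)
  have w2': "w\<^sup>2 = 1 - (s - 1)\<^sup>2 - (x$2)\<^sup>2" by (simp add: w2 norm_sq_2 s_def)
  have p: "p = (s - 1) * v$1 + x$2 * v$2" by (simp add: p_def inner_2 s_def)
  have y2: "y2 > 0" using s w by (simp add: y2_def)
  have V: "frechet_derivative funk_to_fp (at x) v = vector [V1, V2]"
    unfolding frechet_derivative_at[OF funk_to_fp_has_derivative[OF assms], symmetric]
      V1_def V2_def p_def s_def w_def ..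
  have y: "funk_to_fp x $ 1 = y1" "funk_to_fp x $ 2 = y2"
    by (simp_all add: funk_to_fp_def y1_def y2_def s_def w_def)
  have m: "4 + (norm (funk_to_fp x))\<^sup>2 = 8 / s"
    unfolding s_def by (rule funk_to_fp_norm_sq[OF assms])
  \<comment> \<open>This identity turns the hyperbolic norm into the Klein form; it is polynomial in
    \<open>s\<close>, \<open>x$2\<close> and \<open>v\<close> once \<open>w2'\<close> has eliminated
    \<open>w\<^sup>2\<close>.\<close>
  have poly: "w\<^sup>2 * (v$2 * s - x$2 * v$1)\<^sup>2 + (p * s + w\<^sup>2 * v$1)\<^sup>2
      = s\<^sup>2 * (w\<^sup>2 * ((v$1)\<^sup>2 + (v$2)\<^sup>2) + p\<^sup>2)"
    unfolding p w2' by (simp add: power2_eq_square algebra_simps)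
  have "(2 * a / s\<^sup>2)\<^sup>2 + (- 2 * b / (w * s\<^sup>2))\<^sup>2 = 4 * (w\<^sup>2 * a\<^sup>2 + b\<^sup>2) / (w\<^sup>2 * (s\<^sup>2)\<^sup>2)" for a b
    using s w by (simp add: power_divide power_mult_distrib divide_simps)
  then have "V1\<^sup>2 + V2\<^sup>2 = 4 * (w\<^sup>2 * (v$2 * s - x$2 * v$1)\<^sup>2 + (p * s + w\<^sup>2 * v$1)\<^sup>2) / (w\<^sup>2 * (s\<^sup>2)\<^sup>2)"
    unfolding V1_def V2_def .
  also have "\<dots> = (y2 / w\<^sup>2)\<^sup>2 * (w\<^sup>2 * (norm v)\<^sup>2 + p\<^sup>2)"
    unfolding poly norm_sq_2[of v] using s w by (simp add: y2_def power2_eq_square divide_simps)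
  finally have "norm (vector [V1, V2] :: real^2) = sqrt ((y2 / w\<^sup>2)\<^sup>2 * (w\<^sup>2 * (norm v)\<^sup>2 + p\<^sup>2))"
    using norm_sq_2[of "vector [V1, V2]"] by (metis norm_ge_zero real_sqrt_unique vector_2)
  also have "\<dots> = (y2 / w\<^sup>2) * sqrt (w\<^sup>2 * (norm v)\<^sup>2 + p\<^sup>2)"
    using y2 by (simp add: real_sqrt_mult)
  finally have hyp: "norm (vector [V1, V2] :: real^2) / y2 = sqrt (w\<^sup>2 * (norm v)\<^sup>2 + p\<^sup>2) / w\<^sup>2"
    using y2 by simp
  have n: "y1\<^sup>2 + y2\<^sup>2 = 8 / s - 4"
    using m norm_sq_2[of "funk_to_fp x"] by (simp add: y)
  \<comment> \<open>This is half the derivative of \<open>|y|^2 = 8 / s - 4\<close>, as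
    \<open>s\<close> has derivative \<open>v$1\<close>.\<close>
  have dot: "y1 * V1 + y2 * V2 = - 4 * v$1 / s\<^sup>2"
  proof -
    have "x$2 * (v$2 * s - x$2 * v$1) - (p * s + w\<^sup>2 * v$1) = - s * v$1"
      unfolding p w2' by (simp add: power2_eq_square algebra_simps)
    moreover have "y1 * V1 + y2 * V2
        = 4 * (x$2 * (v$2 * s - x$2 * v$1) - (p * s + w\<^sup>2 * v$1)) / (s * s\<^sup>2)"
      using s w by (simp add: y1_def y2_def V1_def V2_def divide_simps)
    ultimately show ?thesis using s by (simp add: power2_eq_square)
  qed
  \<comment> \<open>The two terms correspond to the numerator and the denominator in the
    differential of \<open>ln ((4 + |y|^2) / y_2)\<close>; \<open>dot\<close> and \<open>n\<close>
    evaluate them.\<close>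
  have "fp_form (funk_to_fp x) \<bullet> (vector [V1, V2] :: real^2)
      = 2 * y2 * (y1 * V1 + y2 * V2) - (y1\<^sup>2 + y2\<^sup>2 + 4) * V2"
    by (simp add: fp_form_def inner_2 y power2_eq_square algebra_simps)
  also have "\<dots> = 2 * y2 * (- 4 * v$1 / s\<^sup>2) - 8 / s * V2"
    unfolding dot n by simp
  finally have "fp_form (funk_to_fp x) \<bullet> (vector [V1, V2] :: real^2) / (y2 * (8 / s)) = p / w\<^sup>2"
    using s w by (simp add: y2_def V2_def divide_simps) (simp add: power2_eq_square algebra_simps)
  then show ?thesis
    unfolding fp_metric_def V y m hyp funk_metric_def w2[symmetric] p_def[symmetric] by simp
qed

lemma funk_to_fp_isometry:
  "finsler_isometry funk_metric disc fp_metric upper_half_plane funk_to_fp"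
  unfolding finsler_isometry_def
proof (intro conjI ballI allI)
  \<comment> \<open>Carries the smoothness of \<open>fp_to_funk\<close> over to
    \<open>inv_into\<close>, with which it agrees on the open half plane.\<close>
  have "inv_into disc funk_to_fp y = fp_to_funk y" if "y \<in> upper_half_plane" for y
    using funk_to_fp_bij that
    by (metis bij_betw_imp_inj_on fp_to_funk_in funk_to_fp_fp_to_funk inv_into_f_f)
  then show "smooth_on upper_half_plane (inv_into disc funk_to_fp)"
    by (intro smooth_on_cong[OF open_upper_half_plane _ smooth_on_fp_to_funk]) simp
qed (simp_all add: funk_to_fp_bij smooth_on_funk_to_fp funk_to_fp_isometric)

section \<open>Images of chords\<close>

lemma chord_lines_iff:
  "l \<in> chord_lines \<longleftrightarrow> (\<exists>a b. a \<noteq> 0 \<and> l = {x. a \<bullet> x = b}) \<and> l \<inter> disc \<noteq> {}"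
proof -
  have *: "affine l \<and> aff_dim l = 1 \<longleftrightarrow> (\<exists>a b. a \<noteq> 0 \<and> l = {x. a \<bullet> x = b})"
  proof
    assume "affine l \<and> aff_dim l = 1"
    then show "\<exists>a b. a \<noteq> 0 \<and> l = {x. a \<bullet> x = b}"
      \<comment> \<open>An affine set is its own affine hull, and in the plane dimension one is
        codimension one.\<close>
      using aff_dim_eq_hyperplane[of l] by (simp add: affine_hull_eq[THEN iffD2])
  next
    assume "\<exists>a b. a \<noteq> 0 \<and> l = {x. a \<bullet> x = b}"
    then show "affine l \<and> aff_dim l = 1"
      by (auto simp: affine_hyperplane aff_dim_hyperplane)
  qed
  show ?thesis unfolding chord_lines_def mem_Collect_eq *[symmetric] by blast
qed

text \<open>The image consists of those \<open>y\<close> whose preimage satisfies the equation of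
  the line; multiplying by the positive \<open>4 + |y|^2\<close> clears the denominator.\<close>

lemma funk_to_fp_image_line:
  "funk_to_fp ` ({x. a \<bullet> x = b} \<inter> disc) =
    {y \<in> upper_half_plane. (a$1 + b) * (norm y)\<^sup>2 - 4 * a$2 * y$1 + 4 * (b - a$1) = 0}"
proof -
  have "a \<bullet> fp_to_funk y = b \<longleftrightarrow> (a$1 + b) * (norm y)\<^sup>2 - 4 * a$2 * y$1 + 4 * (b - a$1) = 0" for y
  proof -
    have "a \<bullet> fp_to_funk y = (a$1 * (4 - (norm y)\<^sup>2) + 4 * a$2 * y$1) / (4 + (norm y)\<^sup>2)"
      by (simp add: inner_2 fp_to_funk_def add_divide_distrib)
    then have "a \<bullet> fp_to_funk y = b \<longleftrightarrow> a$1 * (4 - (norm y)\<^sup>2) + 4 * a$2 * y$1 = b * (4 + (norm y)\<^sup>2)"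
      using norm_sq_plus_4[of y] by (simp add: divide_eq_eq)
    then show ?thesis by (auto simp: algebra_simps)
  qed
  moreover have "funk_to_fp ` ({x. a \<bullet> x = b} \<inter> disc) = {y \<in> upper_half_plane. a \<bullet> fp_to_funk y = b}"
  proof (intro equalityI subsetI)
    fix y assume "y \<in> {y \<in> upper_half_plane. a \<bullet> fp_to_funk y = b}"
    then show "y \<in> funk_to_fp ` ({x. a \<bullet> x = b} \<inter> disc)"
      by (intro image_eqI[of _ _ "fp_to_funk y"]) (simp_all add: funk_to_fp_fp_to_funk fp_to_funk_in)
  qed (auto simp: funk_to_fp_in fp_to_funk_funk_to_fp)
  ultimately show ?thesis by simp
qed

lemma vertical_ray_nonempty: "vertical_ray a \<noteq> {}"
proof -
  have "vector [a, 1] \<in> vertical_ray a" by (simp add: vertical_ray_def upper_half_plane_def)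
  then show ?thesis by blast
qed

text \<open>Squaring the distance is reversible as \<open>r > 0\<close>, and brings the semicircle
  into the shape of the equation in \<open>funk_to_fp_image_line\<close>.\<close>

lemma semicircle_iff:
  assumes "r > 0"
  shows "y \<in> semicircle a r \<longleftrightarrow> y \<in> upper_half_plane \<and> (norm y)\<^sup>2 - 2 * a * y$1 + (a\<^sup>2 - r\<^sup>2) = 0"
proof -
  have "dist y (vector [a, 0]) = r \<longleftrightarrow> (dist y (vector [a, 0]))\<^sup>2 = r\<^sup>2"
    using assms by (simp add: power2_eq_iff_nonneg)
  also have "(dist y (vector [a, 0]))\<^sup>2 = (norm y)\<^sup>2 - 2 * a * y$1 + a\<^sup>2"
    unfolding dist_norm norm_sq_2 by (simp add: power2_eq_square algebra_simps)
  finally show ?thesis by (auto simp: semicircle_def)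
qed

lemma semicircle_nonempty:
  assumes "r > 0" shows "semicircle a r \<noteq> {}"
proof -
  have "vector [a, r] \<in> semicircle a r"
    unfolding semicircle_iff[OF assms] norm_sq_2 using assms
    by (simp add: upper_half_plane_def power2_eq_square)
  then show ?thesis by blast
qed

lemma funk_to_fp_image_line_vertical_ray:
  assumes "a$1 + b = 0" "a$2 \<noteq> 0"
  shows "funk_to_fp ` ({x. a \<bullet> x = b} \<inter> disc) = vertical_ray (- 2 * a$1 / a$2)"
proof -
  have b: "b = - a$1" using assms(1) by linarith
  have "- 4 * a$2 * t + 4 * (b - a$1) = 0 \<longleftrightarrow> t = - 2 * a$1 / a$2" for t
    using assms(2) by (auto simp: b field_simps)
  then show ?thesis
    unfolding funk_to_fp_image_line vertical_ray_def using assms(1) by auto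
qed

text \<open>Division by \<open>a$1 + b\<close> normalises the image equation. The radius enters
  through a hypothesis, so the lemma serves both to find the semicircle of a chord and to verify a
  chord chosen for a semicircle.\<close>

lemma funk_to_fp_image_line_semicircle:
  assumes "a$1 + b \<noteq> 0" "r > 0"
    and r: "r\<^sup>2 = (2 * a$2 / (a$1 + b))\<^sup>2 - 4 * (b - a$1) / (a$1 + b)"
  shows "funk_to_fp ` ({x. a \<bullet> x = b} \<inter> disc) = semicircle (2 * a$2 / (a$1 + b)) r"
proof -
  define k q where "k = a$1 + b" and "q = 4 * (b - a$1) / k"
  have k: "k \<noteq> 0" and q: "4 * (b - a$1) = k * q" using assms(1) by (simp_all add: k_def q_def)
  have "k * n - 4 * a$2 * t + 4 * (b - a$1) = 0 \<longleftrightarrow>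
      n - 2 * (2 * a$2 / k) * t + ((2 * a$2 / k)\<^sup>2 - r\<^sup>2) = 0" for n t
  proof -
    have "k * n - 4 * a$2 * t + k * q = k * (n - 2 * (2 * a$2 / k) * t + q)"
      using k by (simp add: distrib_left right_diff_distrib)
    moreover have "(2 * a$2 / k)\<^sup>2 - r\<^sup>2 = q" using r by (simp add: k_def q_def)
    ultimately show ?thesis using k unfolding q by simp
  qed
  then show ?thesis
    unfolding funk_to_fp_image_line k_def[symmetric] by (auto simp: semicircle_iff[OF assms(2)])
qed

text \<open>The prospective squared radius \<open>c\<^sup>2 - q\<close> is positive because the
  chord is nonempty: a point \<open>y\<close> of its image expresses it as
  \<open>(y_1 - c)^2 + y_2^2\<close> with \<open>y_2 > 0\<close>.\<close>

lemma chord_image_semicircle: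
  assumes "{x. a \<bullet> x = b} \<inter> disc \<noteq> {}" "a$1 + b \<noteq> 0"
  obtains r where "r > 0"
    "funk_to_fp ` ({x. a \<bullet> x = b} \<inter> disc) = semicircle (2 * a$2 / (a$1 + b)) r"
proof -
  define k q where "k = a$1 + b" and "q = 4 * (b - a$1) / k"
  have k: "k \<noteq> 0" and q: "4 * (b - a$1) = k * q" using assms(2) by (simp_all add: k_def q_def)
  define c where "c = 2 * a$2 / k"
  obtain y where y: "y \<in> upper_half_plane" "k * (norm y)\<^sup>2 - 4 * a$2 * y$1 + 4 * (b - a$1) = 0"
    using assms(1) funk_to_fp_image_line[of a b] unfolding k_def by blast
  have "k * ((norm y)\<^sup>2 - 2 * c * y$1 + q) = 0"
    using y(2) k unfolding q c_def by (simp add: distrib_left right_diff_distrib)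
  then have "(norm y)\<^sup>2 - 2 * c * y$1 + q = 0" using k by simp
  then have "c\<^sup>2 - q = (y$1 - c)\<^sup>2 + (y$2)\<^sup>2"
    unfolding norm_sq_2 power2_diff by (simp add: algebra_simps)
  moreover have "(y$2)\<^sup>2 > 0" using y(1) by (simp add: upper_half_plane_def)
  ultimately have "c\<^sup>2 - q > 0" by (simp add: add_nonneg_pos)
  then show ?thesis
    by (intro that[of "sqrt (c\<^sup>2 - q)"] funk_to_fp_image_line_semicircle assms(2))
      (simp_all add: c_def q_def k_def)
qed

section \<open>The three correspondences and the geodesics of the half plane\<close>

lemma chords_vertical_rays:
  "{funk_to_fp ` (l \<inter> disc) | l. l \<in> chord_lines \<and> vector [-1, 0] \<in> l} = {vertical_ray a | a. True}"
proof (intro equalityI subsetI; clarify)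
  fix l assume "l \<in> chord_lines" and m: "vector [-1, 0] \<in> l"
  then obtain a b where a: "a \<noteq> 0" and l: "l = {x. a \<bullet> x = b}" "l \<inter> disc \<noteq> {}"
    unfolding chord_lines_iff by blast
  have ab: "a$1 + b = 0" using m by (simp add: l(1) inner_2)
  have "a$2 \<noteq> 0"
  proof
    \<comment> \<open>The line would then be \<open>x_1 = -1\<close>, which is tangent to the unit
      circle and misses the disc.\<close>
    assume a2: "a$2 = 0"
    then have "a$1 \<noteq> 0" using a by (simp add: vec_eq_2)
    obtain x where x: "x \<in> disc" "a \<bullet> x = b" using l by blast
    have "a$1 * (1 + x$1) = 0" using x(2) ab a2 by (simp add: inner_2 distrib_left)
    then show False using \<open>a$1 \<noteq> 0\<close> disc_first_coordinate[OF x(1)] by simp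
  qed
  then show "\<exists>c. funk_to_fp ` (l \<inter> disc) = vertical_ray c \<and> True"
    using funk_to_fp_image_line_vertical_ray[OF ab] l(1) by blast
next
  fix c :: real
  \<comment> \<open>Solves \<open>- 2 * a$1 / a$2 = c\<close> with the normalisation
    \<open>a$2 = 1\<close>; the right-hand side \<open>c / 2\<close> is
    \<open>- a$1\<close>.\<close>
  define a :: "real^2" where "a = vector [- c / 2, 1]"
  let ?l = "{x. a \<bullet> x = c / 2}"
  have im: "funk_to_fp ` (?l \<inter> disc) = vertical_ray c"
    using funk_to_fp_image_line_vertical_ray[of a "c / 2"] by (simp add: a_def)
  moreover have "a \<noteq> 0" by (simp add: a_def vec_eq_2)
  \<comment> \<open>The line meets the disc because its image is nonempty.\<close>
  then have "?l \<in> chord_lines"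
    unfolding chord_lines_iff using im vertical_ray_nonempty[of c] by blast
  moreover have "vector [-1, 0] \<in> ?l" by (simp add: a_def inner_2)
  ultimately show "\<exists>l. vertical_ray c = funk_to_fp ` (l \<inter> disc) \<and> l \<in> chord_lines \<and> vector [-1, 0] \<in> l"
    by metis
qed

lemma vertical_line_iff:
  assumes "a \<noteq> 0" shows "vertical_line {x. a \<bullet> x = b} \<longleftrightarrow> a$2 = 0"
proof
  assume "vertical_line {x. a \<bullet> x = b}"
  then obtain d where d: "{x. a \<bullet> x = b} = {x. x$1 = d}" unfolding vertical_line_def by blast
  \<comment> \<open>Two points of the vertical line at different heights have the same product with
    \<open>a\<close>.\<close>
  have "vector [d, 0] \<in> {x. a \<bullet> x = b}" "vector [d, 1] \<in> {x. a \<bullet> x = b}"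
    unfolding d by simp_all
  then show "a$2 = 0" by (simp add: inner_2)
next
  assume a2: "a$2 = 0"
  then have "a$1 \<noteq> 0" using assms by (simp add: vec_eq_2)
  then have "{x. a \<bullet> x = b} = {x. x$1 = b / a$1}"
    using a2 by (auto simp: inner_2 field_simps)
  then show "vertical_line {x. a \<bullet> x = b}" unfolding vertical_line_def by blast
qed

lemma chords_semicircles_origin:
  "{funk_to_fp ` (l \<inter> disc) | l. l \<in> chord_lines \<and> vertical_line l} = {semicircle 0 r | r. r > 0}"
proof (intro equalityI subsetI; clarify)
  fix l assume "l \<in> chord_lines" and v: "vertical_line l"
  then obtain a b where a: "a \<noteq> 0" and l: "l = {x. a \<bullet> x = b}" "l \<inter> disc \<noteq> {}"
    unfolding chord_lines_iff by blast
  have a2: "a$2 = 0" using v vertical_line_iff[OF a] l(1) by simp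
  then have "a$1 \<noteq> 0" using a by (simp add: vec_eq_2)
  obtain x where x: "x \<in> disc" "a \<bullet> x = b" using l by blast
  \<comment> \<open>A vertical line meeting the disc avoids \<open>(-1, 0)\<close>, as
    \<open>x_1 > -1\<close> on the disc; so its image is no ray.\<close>
  have "a$1 + b = a$1 * (1 + x$1)" using x(2) a2 by (simp add: inner_2 distrib_left)
  then have ab: "a$1 + b \<noteq> 0" using \<open>a$1 \<noteq> 0\<close> disc_first_coordinate[OF x(1)] by simp
  obtain r where "r > 0" "funk_to_fp ` (l \<inter> disc) = semicircle (2 * a$2 / (a$1 + b)) r"
    using chord_image_semicircle[OF _ ab] l by metis
  then show "\<exists>r. funk_to_fp ` (l \<inter> disc) = semicircle 0 r \<and> r > 0"
    using a2 by auto
next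
  fix r :: real assume r: "r > 0"
  \<comment> \<open>For \<open>a$2 = 0\<close> the squared radius is
    \<open>4 (a_1 - b) / (a_1 + b)\<close>, which is \<open>r\<^sup>2\<close> for
    \<open>a_1 = 4 + r^2\<close> and \<open>b = 4 - r^2\<close>.\<close>
  define a :: "real^2" where "a = vector [4 + r\<^sup>2, 0]"
  let ?l = "{x. a \<bullet> x = 4 - r\<^sup>2}"
  have a: "a \<noteq> 0" using norm_sq_plus_4[of r] by (auto simp: a_def vec_eq_2)
  have im: "funk_to_fp ` (?l \<inter> disc) = semicircle 0 r"
    using funk_to_fp_image_line_semicircle[of a "4 - r\<^sup>2" r] r by (simp add: a_def)
  moreover have "?l \<in> chord_lines"
    unfolding chord_lines_iff using im semicircle_nonempty[OF r] a by blast
  moreover have "vertical_line ?l" unfolding vertical_line_iff[OF a] by (simp add: a_def)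
  ultimately show "\<exists>l. semicircle 0 r = funk_to_fp ` (l \<inter> disc) \<and> l \<in> chord_lines \<and> vertical_line l"
    by metis
qed

lemma chords_semicircles_off_origin:
  "{funk_to_fp ` (l \<inter> disc) | l. l \<in> chord_lines \<and> vector [-1, 0] \<notin> l \<and> \<not> vertical_line l} =
    {semicircle a r | a r. a \<noteq> 0 \<and> r > 0}"
proof (intro equalityI subsetI; clarify)
  fix l assume "l \<in> chord_lines" and m: "vector [-1, 0] \<notin> l" and v: "\<not> vertical_line l"
  then obtain a b where a: "a \<noteq> 0" and l: "l = {x. a \<bullet> x = b}" "l \<inter> disc \<noteq> {}"
    unfolding chord_lines_iff by blast
  have a2: "a$2 \<noteq> 0" using v vertical_line_iff[OF a] l(1) by simp
  have ab: "a$1 + b \<noteq> 0" using m by (auto simp: l(1) inner_2)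
  obtain r where "r > 0" "funk_to_fp ` (l \<inter> disc) = semicircle (2 * a$2 / (a$1 + b)) r"
    using chord_image_semicircle[OF _ ab] l by metis
  moreover have "2 * a$2 / (a$1 + b) \<noteq> 0" using a2 ab by simp
  ultimately show "\<exists>c r. funk_to_fp ` (l \<inter> disc) = semicircle c r \<and> c \<noteq> 0 \<and> r > 0" by blast
next
  fix c r :: real assume c: "c \<noteq> 0" and r: "r > 0"
  \<comment> \<open>Under the normalisation \<open>a$1 + ?b = 1\<close> the centre is
    \<open>2 * a$2\<close> and the squared radius \<open>c\<^sup>2 - 4 * (?b - a$1)\<close>; this
    forces \<open>a$2 = c / 2\<close> and \<open>?b - a$1 = m\<close>.\<close>
  define m where "m = (c\<^sup>2 - r\<^sup>2) / 4"
  define a :: "real^2" where "a = vector [(1 - m) / 2, c / 2]"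
  let ?b = "(1 + m) / 2"
  let ?l = "{x. a \<bullet> x = ?b}"
  have ab: "a$1 + ?b = 1" "?b - a$1 = m" by (simp_all add: a_def field_simps)
  have a: "a \<noteq> 0" using c by (auto simp: a_def vec_eq_2)
  have "r\<^sup>2 = (2 * a$2 / (a$1 + ?b))\<^sup>2 - 4 * (?b - a$1) / (a$1 + ?b)"
    unfolding ab by (simp add: a_def m_def field_simps)
  then have "funk_to_fp ` (?l \<inter> disc) = semicircle (2 * a$2 / (a$1 + ?b)) r"
    by (intro funk_to_fp_image_line_semicircle r) (simp_all add: ab)
  then have im: "funk_to_fp ` (?l \<inter> disc) = semicircle c r"
    unfolding ab by (simp add: a_def)
  moreover have "?l \<in> chord_lines"
    unfolding chord_lines_iff using im semicircle_nonempty[OF r] a by blast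
  moreover have "\<not> vertical_line ?l" unfolding vertical_line_iff[OF a] using c by (simp add: a_def)
  moreover have "vector [-1, 0] \<notin> ?l"
  proof
    assume "vector [-1, 0] \<in> ?l"
    then have "- a$1 = ?b" by (simp add: inner_2)
    then show False using ab(1) by linarith
  qed
  ultimately show "\<exists>l. semicircle c r = funk_to_fp ` (l \<inter> disc) \<and>
      l \<in> chord_lines \<and> vector [-1, 0] \<notin> l \<and> \<not> vertical_line l"
    by metis
qed

lemma fp_geodesic_trajectories:
  "geodesic_trajectories fp_metric upper_half_plane =
    {vertical_ray a | a. True} \<union> {semicircle a r | a r. r > 0}"
proof -
  have "geodesic_trajectories fp_metric upper_half_plane =
      {funk_to_fp ` (l \<inter> disc) | l. l \<in> chord_lines}"
    unfolding isometry_geodesic_trajectories[OF funk_to_fp_isometry open_disc open_upper_half_plane]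
      funk_geodesic_trajectories by blast
  \<comment> \<open>Every chord line passes through \<open>(-1, 0)\<close>, is vertical, or does
    neither; the last two classes together give the semicircles with arbitrary centre.\<close>
  also have "\<dots> = {funk_to_fp ` (l \<inter> disc) | l. l \<in> chord_lines \<and> vector [-1, 0] \<in> l}
      \<union> {funk_to_fp ` (l \<inter> disc) | l. l \<in> chord_lines \<and> vertical_line l}
      \<union> {funk_to_fp ` (l \<inter> disc) | l. l \<in> chord_lines \<and> vector [-1, 0] \<notin> l \<and> \<not> vertical_line l}"
    by blast
  also have "\<dots> = {vertical_ray a | a. True} \<union> {semicircle a r | a r. r > 0}"
    unfolding chords_vertical_rays chords_semicircles_origin chords_semicircles_off_origin by blast
  finally show ?thesis .
qed

theorem theorem4p1:
  shows "geodesic_trajectories fp_metric upper_half_plane =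
           {vertical_ray a | a. True} \<union> {semicircle a r | a r. r > 0}
       \<and> finsler_isometry funk_metric disc fp_metric upper_half_plane funk_to_fp
       \<and> {funk_to_fp ` (l \<inter> disc) | l. l \<in> chord_lines \<and> vector [-1, 0] \<in> l} =
           {vertical_ray a | a. True}
       \<and> {funk_to_fp ` (l \<inter> disc) | l. l \<in> chord_lines \<and> vertical_line l} =
           {semicircle 0 r | r. r > 0}
       \<and> {funk_to_fp ` (l \<inter> disc) | l.
             l \<in> chord_lines \<and> vector [-1, 0] \<notin> l \<and> \<not> vertical_line l} =
           {semicircle a r | a r. a \<noteq> 0 \<and> r > 0}"
  by (intro conjI fp_geodesic_trajectories funk_to_fp_isometry chords_vertical_rays
      chords_semicircles_origin chords_semicircles_off_origin)

end
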